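(* Let $X$ be a Banach space that contains uniformly complemented $(\ell_2^n)_{n=1}^\infty$. Then, for every integer $k\geq2$, neither $\mathcal{P}({}^kX)$ nor $\mathcal{P}^k_0(X)$ is complemented in $\mathrm{Lip}_0(B_X)$.
   Context: All Banach spaces are real; $B_X$ is the closed unit ball of $X$. $\ell_2^n$ is $(\mathbb{R}^n,\|\cdot\|_2)$. $X$ contains uniformly complemented $(\ell_2^n)_{n=1}^\infty$ if there are a constant $C$ and a sequence $(F_n)_{n=1}^\infty$ of subspaces of $X$ such that, for each $n$, $F_n$ is $C$-isomorphic to $\ell_2^n$ (there is a linear isomorphism $T\colon \ell_2^n\to F_n$ with $\|T\|\,\|T^{-1}\|\leq C$) and $F_n$ is $C$-complemented in $X$ (there is a linear projection of norm at most $C$ from $X$ onto $F_n$). $\mathrm{Lip}_0(B_X)$ is the Banach space of all Lipschitz functions $f\colon B_X\to\mathbb{R}$ with $f(0)=0$, with norm the best Lipschitz constant of $f$. For $j\geq1$, $\mathcal{P}({}^jX)$ is the space of $j$-homogeneous polynomials on $X$, i.e. functions $P\colon X\to\mathbb{R}$ of the form $P(x)=M(x,\dots,x)$ with $M\colon X^j\to\mathbb{R}$ a bounded $j$-linear form; $\mathcal{P}({}^0X)$ is the space of constant functions. $\mathcal{P}^k(X)$ is the space of polynomials of degree at most $k$, i.e. functions $P=\sum_{j=0}^kP_j$ with $P_j\in\mathcal{P}({}^jX)$, and $\mathcal{P}^k_0(X)$ is its closed subspace of those $P$ with $P(0)=0$ (equivalently $P_0=0$). All these spaces are normed by $\|P\|_{\mathcal{P}}=\sup_{x\in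 B_X}|P(x)|$. The restriction map $P\mapsto P|_{B_X}$ is an isomorphic embedding of $\mathcal{P}({}^kX)$ and of $\mathcal{P}^k_0(X)$ into $\mathrm{Lip}_0(B_X)$, and these spaces are identified with their images under this map. A subspace is complemented if it is the range of a bounded linear projection. *)

theory Defs
  imports "HOL-Analysis.Analysis"
begin

text \<open>
  As \<open>n\<close> varies inside the statement, \<open>\<ell>\<^sub>2\<^sup>n\<close> is realised on the sequences supported on
  \<open>{..<n}\<close>, normed by \<^term>\<open>\<lambda>c. L2_set c {..<n}\<close>.
\<close>

definition ell2 :: "nat \<Rightarrow> (nat \<Rightarrow> real) set" where
  "ell2 n = {c. \<forall>i\<ge>n. c i = 0}"

text \<open>
  The norm of a linear map \<open>T\<close> from the space \<open>S\<close> with norm \<open>N\<close> to a space with norm \<open>M\<close>.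
  Below \<open>S\<close> is always finite-dimensional, so the supremum is that of a bounded set.
\<close>

definition opnorm_on :: "'b set \<Rightarrow> ('b \<Rightarrow> real) \<Rightarrow> ('c \<Rightarrow> real) \<Rightarrow> ('b \<Rightarrow> 'c) \<Rightarrow> real" where
  "opnorm_on S N M T = (SUP x\<in>{x \<in> S. N x \<le> 1}. M (T x))"

definition ell2_iso :: "nat \<Rightarrow> ((nat \<Rightarrow> real) \<Rightarrow> 'a::real_normed_vector) \<Rightarrow> 'a set \<Rightarrow> bool" where
  "ell2_iso n T F \<longleftrightarrow>
     (\<forall>c\<in>ell2 n. \<forall>d\<in>ell2 n. T (\<lambda>i. c i + d i) = T c + T d) \<and>
     (\<forall>r. \<forall>c\<in>ell2 n. T (\<lambda>i. r * c i) = r *\<^sub>R T c) \<and>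
     bij_betw T (ell2 n) F"

definition isomorphic_ell2 :: "real \<Rightarrow> nat \<Rightarrow> 'a::real_normed_vector set \<Rightarrow> bool" where
  "isomorphic_ell2 C n F \<longleftrightarrow>
     (\<exists>T. ell2_iso n T F \<and>
          opnorm_on (ell2 n) (\<lambda>c. L2_set c {..<n}) norm T *
          opnorm_on F norm (\<lambda>c. L2_set c {..<n}) (inv_into (ell2 n) T) \<le> C)"

definition projection_onto :: "('a::real_normed_vector \<Rightarrow> 'a) \<Rightarrow> 'a set \<Rightarrow> bool" where
  "projection_onto Q F \<longleftrightarrow> bounded_linear Q \<and> (\<forall>x. Q (Q x) = Q x) \<and> range Q = F"

definition contains_uniformly_complemented_ell2 :: "'a::real_normed_vector itself \<Rightarrow> bool" where
  "contains_uniformly_complemented_ell2 _ \<longleftrightarrow>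
     (\<exists>(C::real) (F :: nat \<Rightarrow> 'a set). \<forall>n\<ge>1.
        subspace (F n) \<and>
        isomorphic_ell2 C n (F n) \<and>
        (\<exists>Q. projection_onto Q (F n) \<and> onorm Q \<le> C))"

definition complemented :: "'a::real_normed_vector set \<Rightarrow> bool" where
  "complemented V \<longleftrightarrow> (\<exists>Q. projection_onto Q V)"

text \<open>
  A \<open>j\<close>-linear form on \<open>'a\<close> is a function on the lists of length \<open>j\<close>; its values on other
  lists are irrelevant.
\<close>

definition bounded_multilinear :: "nat \<Rightarrow> ('a::real_normed_vector list \<Rightarrow> real) \<Rightarrow> bool" where
  "bounded_multilinear j M \<longleftrightarrow>
     (\<forall>xs. length xs = j \<longrightarrow> (\<forall>i<j. linear (\<lambda>y. M (xs[i := y])))) \<and>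
     (\<exists>K. \<forall>xs. length xs = j \<longrightarrow> \<bar>M xs\<bar> \<le> K * prod_list (map norm xs))"

text \<open>For \<open>j = 0\<close> this yields exactly the constant functions.\<close>

definition hom_polys :: "nat \<Rightarrow> ('a::real_normed_vector \<Rightarrow> real) set" where
  "hom_polys j = {P. \<exists>M. bounded_multilinear j M \<and> (\<forall>x. P x = M (replicate j x))}"

definition polys :: "nat \<Rightarrow> ('a::real_normed_vector \<Rightarrow> real) set" where
  "polys k = {P. \<exists>R. (\<forall>j\<le>k. R j \<in> hom_polys j) \<and> (\<forall>x. P x = (\<Sum>j\<le>k. R j x))}"

definition polys0 :: "nat \<Rightarrow> ('a::real_normed_vector \<Rightarrow> real) set" where
  "polys0 k = {P \<in> polys k. P 0 = 0}"

text \<open>A function on the unit ball is represented by its extension by \<open>0\<close> to the whole space.\<close>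

definition lip0_set :: "('a::real_normed_vector \<Rightarrow> real) set" where
  "lip0_set = {f. (\<exists>L. L-lipschitz_on (cball 0 1) f) \<and> f 0 = 0 \<and> (\<forall>x. x \<notin> cball 0 1 \<longrightarrow> f x = 0)}"

typedef (overloaded) 'a lip0 = "lip0_set :: ('a::real_normed_vector \<Rightarrow> real) set"
  morphisms lip0_apply Abs_lip0
  by (rule exI[of _ "\<lambda>_. 0"]) (auto simp: lip0_set_def intro: lipschitz_on_constant)

setup_lifting type_definition_lip0

instantiation lip0 :: (real_normed_vector) real_vector
begin

lift_definition zero_lip0 :: "'a lip0" is "\<lambda>_. 0"
  by (auto simp: lip0_set_def intro: lipschitz_on_constant)

lift_definition plus_lip0 :: "'a lip0 \<Rightarrow> 'a lip0 \<Rightarrow> 'a lip0" is "\<lambda>f g x. f x + g x"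
  by (auto simp: lip0_set_def intro: lipschitz_on_add)

lift_definition minus_lip0 :: "'a lip0 \<Rightarrow> 'a lip0 \<Rightarrow> 'a lip0" is "\<lambda>f g x. f x - g x"
  by (auto simp: lip0_set_def intro: lipschitz_on_diff)

lift_definition uminus_lip0 :: "'a lip0 \<Rightarrow> 'a lip0" is "\<lambda>f x. - f x"
  by (auto simp: lip0_set_def)

lift_definition scaleR_lip0 :: "real \<Rightarrow> 'a lip0 \<Rightarrow> 'a lip0" is "\<lambda>r f x. r * f x"
  by (auto simp: lip0_set_def intro: lipschitz_on_cmult_real)

instance
  by standard (transfer, simp add: algebra_simps fun_eq_iff)+

end

lift_definition best_lipschitz :: "'a::real_normed_vector lip0 \<Rightarrow> real"
  is "\<lambda>f. Inf {L. L-lipschitz_on (cball 0 1) f}" .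

lemma best_lipschitz_lipschitz: "(best_lipschitz f)-lipschitz_on (cball 0 1) (lip0_apply f)"
proof transfer
  fix f :: "'a \<Rightarrow> real"
  let ?S = "{L. L-lipschitz_on (cball 0 1) f}"
  assume "f \<in> lip0_set"
  then have ne: "?S \<noteq> {}"
    by (auto simp: lip0_set_def)
  show "(Inf ?S)-lipschitz_on (cball 0 1) f"
  proof (rule lipschitz_onI)
    show "0 \<le> Inf ?S"
      by (intro cInf_greatest ne) (auto dest: lipschitz_on_nonneg)
    fix x y :: 'a
    assume xy: "x \<in> cball 0 1" "y \<in> cball 0 1"
    show "dist (f x) (f y) \<le> Inf ?S * dist x y"
    proof (cases "x = y")
      case False
      have "dist (f x) (f y) / dist x y \<le> Inf ?S"
        using False xy
        by (intro cInf_greatest ne) (auto simp: divide_le_eq dest: lipschitz_onD)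
      with False show ?thesis
        by (simp add: divide_le_eq)
    qed simp
  qed
qed

lemma best_lipschitz_le:
  assumes "L-lipschitz_on (cball 0 1) (lip0_apply f)"
  shows "best_lipschitz f \<le> L"
  using assms
  by transfer (auto intro!: cInf_lower bdd_belowI[of _ 0] dest: lipschitz_on_nonneg)

instantiation lip0 :: (real_normed_vector) real_normed_vector
begin

definition norm_lip0 :: "'a lip0 \<Rightarrow> real" where
  "norm_lip0 f = best_lipschitz f"

definition dist_lip0 :: "'a lip0 \<Rightarrow> 'a lip0 \<Rightarrow> real" where
  "dist_lip0 f g = norm (f - g)"

definition sgn_lip0 :: "'a lip0 \<Rightarrow> 'a lip0" where
  "sgn_lip0 f = f /\<^sub>R norm f"

definition uniformity_lip0 :: "('a lip0 \<times> 'a lip0) filter" where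
  "uniformity_lip0 = (INF e\<in>{0<..}. principal {(f, g). dist f g < e})"

definition open_lip0 :: "'a lip0 set \<Rightarrow> bool" where
  "open_lip0 U = (\<forall>f\<in>U. \<forall>\<^sub>F (f', g) in uniformity. f' = f \<longrightarrow> g \<in> U)"

instance
proof
  fix f g :: "'a lip0" and r :: real
  show "norm f = 0 \<longleftrightarrow> f = 0"
  proof
    assume "norm f = 0"
    then have "0-lipschitz_on (cball 0 1) (lip0_apply f)"
      using best_lipschitz_lipschitz[of f] by (simp add: norm_lip0_def)
    then show "f = 0"
    proof (transfer, intro ext)
      fix f :: "'a \<Rightarrow> real" and x :: 'a
      assume f: "f \<in> lip0_set" "0-lipschitz_on (cball 0 1) f"
      show "f x = 0"
        using f lipschitz_onD[OF f(2), of x 0]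
        by (cases "x \<in> cball 0 1") (auto simp: lip0_set_def)
    qed
  next
    assume f: "f = 0"
    have "best_lipschitz f \<le> 0"
      unfolding f by (intro best_lipschitz_le) (transfer, rule lipschitz_on_constant)
    then show "norm f = 0"
      using lipschitz_on_nonneg[OF best_lipschitz_lipschitz[of f]] by (simp add: norm_lip0_def)
  qed
  show "norm (f + g) \<le> norm f + norm g"
    unfolding norm_lip0_def
    by (rule best_lipschitz_le)
      (simp add: plus_lip0.rep_eq lipschitz_on_add best_lipschitz_lipschitz)
  have le: "norm (s *\<^sub>R h) \<le> \<bar>s\<bar> * norm h" for s and h :: "'a lip0"
    unfolding norm_lip0_def
    by (rule best_lipschitz_le)
      (simp add: scaleR_lip0.rep_eq lipschitz_on_cmult_real best_lipschitz_lipschitz)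
  show "norm (r *\<^sub>R f) = \<bar>r\<bar> * norm f"
  proof (cases "r = 0")
    case True
    then show ?thesis
      using le[of 0 f] lipschitz_on_nonneg[OF best_lipschitz_lipschitz[of "0 *\<^sub>R f"]]
      by (simp add: norm_lip0_def)
  next
    case False
    then have "norm f \<le> \<bar>inverse r\<bar> * norm (r *\<^sub>R f)"
      using le[of "inverse r" "r *\<^sub>R f"] by simp
    with False le[of r f] show ?thesis
      by (simp add: field_simps)
  qed
qed (simp_all add: dist_lip0_def sgn_lip0_def uniformity_lip0_def open_lip0_def)

end

lemma lipschitz_lip0: "(norm f)-lipschitz_on (cball 0 1) (lip0_apply f)"
  by (simp add: norm_lip0_def best_lipschitz_lipschitz)

lemma norm_lip0_le: "L-lipschitz_on (cball 0 1) (lip0_apply f) \<Longrightarrow> norm f \<le> L"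
  by (simp add: norm_lip0_def best_lipschitz_le)

lemma lip0_apply_le: "\<bar>lip0_apply f x\<bar> \<le> norm f"
proof (cases "x \<in> cball 0 1")
  case True
  have "lip0_apply f 0 = 0"
    using lip0_apply[of f] by (simp add: lip0_set_def)
  then have "\<bar>lip0_apply f x\<bar> \<le> norm f * norm x"
    using lipschitz_onD[OF lipschitz_lip0[of f] True, of 0] by (simp add: dist_norm)
  also have "\<dots> \<le> norm f"
    using True by (simp add: mult_left_le)
  finally show ?thesis .
next
  case False
  then show ?thesis
    using lip0_apply[of f] by (simp add: lip0_set_def)
qed

instance lip0 :: (real_normed_vector) banach
proof
  fix X :: "nat \<Rightarrow> 'a lip0"
  assume X: "Cauchy X"
  have "Cauchy (\<lambda>n. lip0_apply (X n) x)" for x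
  proof (rule metric_CauchyI)
    fix e :: real
    assume "e > 0"
    then obtain N where "\<forall>m\<ge>N. \<forall>n\<ge>N. dist (X m) (X n) < e"
      using metric_CauchyD[OF X] by blast
    moreover have "dist (lip0_apply (X m) x) (lip0_apply (X n) x) \<le> dist (X m) (X n)" for m n
      using lip0_apply_le[of "X m - X n" x] by (simp add: dist_norm minus_lip0.rep_eq)
    ultimately show "\<exists>N. \<forall>m\<ge>N. \<forall>n\<ge>N. dist (lip0_apply (X m) x) (lip0_apply (X n) x) < e"
      using le_less_trans by blast
  qed
  then have "\<forall>x. \<exists>l. (\<lambda>n. lip0_apply (X n) x) \<longlonglongrightarrow> l"
    by (simp add: Cauchy_convergent_iff convergent_def)
  then obtain g where g: "\<And>x. (\<lambda>n. lip0_apply (X n) x) \<longlonglongrightarrow> g x"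
    by metis
  obtain K where K: "\<And>n. norm (X n) \<le> K"
    using Cauchy_Bseq[OF X] by (auto simp: Bseq_def)
  have "K-lipschitz_on (cball 0 1) g"
  proof (rule lipschitz_onI)
    show "0 \<le> K"
      using K[of 0] norm_ge_zero order_trans by blast
    fix x y :: 'a
    assume xy: "x \<in> cball 0 1" "y \<in> cball 0 1"
    show "dist (g x) (g y) \<le> K * dist x y"
    proof (rule LIMSEQ_le_const2[OF tendsto_dist[OF g g]], intro exI allI impI)
      fix n
      show "dist (lip0_apply (X n) x) (lip0_apply (X n) y) \<le> K * dist x y"
        using lipschitz_onD[OF lipschitz_lip0[of "X n"] xy] mult_right_mono[OF K[of n], of "dist x y"]
        by simp
    qed
  qed
  moreover have "g x = 0" if "x = 0 \<or> x \<notin> cball 0 1" for x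
  proof -
    have "lip0_apply (X n) x = 0" for n
      using lip0_apply[of "X n"] that by (auto simp: lip0_set_def)
    with g[of x] show ?thesis
      by (simp add: LIMSEQ_const_iff)
  qed
  ultimately have "g \<in> lip0_set"
    by (auto simp: lip0_set_def)
  then have G: "lip0_apply (Abs_lip0 g) = g"
    by (rule Abs_lip0_inverse)
  have "X \<longlonglongrightarrow> Abs_lip0 g"
  proof (rule metric_LIMSEQ_I)
    fix e :: real
    assume e: "e > 0"
    then obtain N where N: "\<And>m n. m \<ge> N \<Longrightarrow> n \<ge> N \<Longrightarrow> dist (X m) (X n) < e / 2"
      using metric_CauchyD[OF X, of "e / 2"] by auto
    have "dist (X m) (Abs_lip0 g) < e" if m: "m \<ge> N" for m
    proof -
      have "norm (X m - Abs_lip0 g) \<le> e / 2"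
      proof (intro norm_lip0_le lipschitz_onI)
        fix x y :: 'a
        assume xy: "x \<in> cball 0 1" "y \<in> cball 0 1"
        let ?h = "\<lambda>n x. lip0_apply (X m) x - lip0_apply (X n) x"
        have "dist (lip0_apply (X m) x - g x) (lip0_apply (X m) y - g y) \<le> e / 2 * dist x y"
        proof (rule LIMSEQ_le_const2)
          show "(\<lambda>n. dist (?h n x) (?h n y))
              \<longlonglongrightarrow> dist (lip0_apply (X m) x - g x) (lip0_apply (X m) y - g y)"
            by (intro tendsto_intros g)
          have "dist (?h n x) (?h n y) \<le> e / 2 * dist x y" if "n \<ge> N" for n
          proof -
            have "dist (?h n x) (?h n y) \<le> norm (X m - X n) * dist x y"
              using lipschitz_onD[OF lipschitz_lip0[of "X m - X n"] xy]
              by (simp add: minus_lip0.rep_eq)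
            also have "\<dots> \<le> e / 2 * dist x y"
              using N[OF m that] by (intro mult_right_mono) (auto simp: dist_norm)
            finally show ?thesis .
          qed
          then show "\<exists>N. \<forall>n\<ge>N. dist (?h n x) (?h n y) \<le> e / 2 * dist x y"
            by blast
        qed
        then show "dist (lip0_apply (X m - Abs_lip0 g) x) (lip0_apply (X m - Abs_lip0 g) y)
            \<le> e / 2 * dist x y"
          by (simp add: minus_lip0.rep_eq G)
      qed (use e in simp)
      with e show ?thesis
        by (simp add: dist_norm)
    qed
    then show "\<exists>N. \<forall>m\<ge>N. dist (X m) (Abs_lip0 g) < e"
      by blast
  qed
  then show "convergent X"
    by (auto simp: convergent_def)
qed

text \<open>
  A polynomial vanishing at \<open>0\<close> is Lipschitz on the unit ball, so for the spaces
  \<^term>\<open>hom_polys k\<close> (\<open>k \<ge> 1\<close>) and \<^term>\<open>polys0 k\<close> the following is the full image under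
  restriction to the ball: the membership in the type \<open>lip0\<close> discards nothing.
\<close>

definition restrictions :: "('a::real_normed_vector \<Rightarrow> real) set \<Rightarrow> 'a lip0 set" where
  "restrictions \<P> = {f. \<exists>P\<in>\<P>. \<forall>x\<in>cball 0 1. lip0_apply f x = P x}"

end

theory Submission
  imports Defs
begin

text \<open>
  Both projections of the theorem are bounded linear maps \<open>Q\<close> of \<open>Lip\<^sub>0(B)\<close> that take values in
  the polynomials of degree at most \<open>k\<close> and fix the \<open>k\<close>-homogeneous ones. No such \<open>Q\<close> exists
  (\<open>no_bounded_retraction_onto_hom_polys\<close>).

  A complemented copy of \<open>\<ell>\<^sub>2\<^sup>n\<close> provides vectors \<open>w\<^sub>i\<close> and functionals \<open>\<psi>\<^sub>i\<close> that are biorthogonal,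
  with \<open>\<Sum>\<psi>\<^sub>i(x)\<^sup>2 \<le> \<parallel>x\<parallel>\<^sup>2\<close> and \<open>\<parallel>\<Sum>c\<^sub>i w\<^sub>i\<parallel> \<le> K \<parallel>c\<parallel>\<^sub>2\<close>, where \<open>K\<close> does not depend on \<open>n\<close>
  (\<open>exists_l2_system\<close>). For signs \<open>\<epsilon>\<close> consider the Riesz product
  \<open>\<Prod>\<^sub>j (1 + \<i> \<epsilon>\<^sub>j \<psi>\<^sub>j(x))\<close>. On the unit ball each factor has modulus \<open>(1 + \<psi>\<^sub>j(x)\<^sup>2)\<^sup>1\<^sup>/\<^sup>2\<close>, so every
  partial product is bounded by \<open>e\<^sup>1\<^sup>/\<^sup>2\<close>, and the product is Lipschitz with a constant of order only
  \<open>\<surd>n\<close> (\<open>riesz_lipschitz\<close>). Yet averaging it over all \<open>\<epsilon>\<close> against the character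
  \<open>\<Prod>\<^sub>i\<^sub>\<in>\<^sub>S \<epsilon>\<^sub>i\<close> with \<open>card S = k\<close> isolates \<open>\<i>\<^sup>k \<Prod>\<^sub>i\<^sub>\<in>\<^sub>S \<psi>\<^sub>i(x)\<close>, a \<open>k\<close>-homogeneous polynomial that \<open>Q\<close> has
  to fix (\<open>test_component\<close>). Hence the image under \<open>Q\<close> of the real part \<open>f\<^sub>\<epsilon>\<close> of
  \<open>(-\<i>)\<^sup>k \<Prod>\<^sub>j (1 + \<i> \<epsilon>\<^sub>j \<psi>\<^sub>j)\<close>, up to a constant, behaves on average over \<open>\<epsilon>\<close> like the sum of all
  signed monomials of degree \<open>k\<close>, which is of size \<open>n\<^sup>k\<^sup>/\<^sup>2\<close> on the ball. For \<open>k \<ge> 2\<close> this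
  grows faster than \<open>\<surd>n\<close>.

  The size is measured by a \<open>k\<close>-fold iterated difference of \<open>Q f\<^sub>\<epsilon>\<close>. As \<open>Q f\<^sub>\<epsilon>\<close> has degree at most
  \<open>k\<close>, this difference is additive in each of its \<open>k\<close> increments (\<open>dif_polys\<close>, \<open>additive_dif\<close>), so that
  two increments made of \<open>N\<close> vectors \<open>w\<^sub>i\<close> each produce \<open>N\<^sup>2\<close> terms, while the other \<open>k - 2\<close>
  increments can be single vectors. After normalisation the average is \<open>N\<close> up to a constant, against
  a bound of order \<open>\<surd>N\<close> (\<open>projection_estimate\<close>).
\<close>

section \<open>Iterated differences of polynomials\<close>

text \<open>
  \<open>dif [h\<^sub>1, \<dots>, h\<^sub>k] f\<close> is \<open>\<Delta>\<^bsub>h\<^sub>k\<^esub> \<cdots> \<Delta>\<^bsub>h\<^sub>1\<^esub> f\<close>, where \<open>\<Delta>\<^sub>h f(x) = f(x + h) - f(x)\<close>. On a polynomial of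
  degree at most \<open>k\<close> it is \<open>k!\<close> times the polar form of its \<open>k\<close>-homogeneous part, so it extracts
  this part from function values alone.
\<close>

fun dif :: "'a::ab_group_add list \<Rightarrow> ('a \<Rightarrow> real) \<Rightarrow> 'a \<Rightarrow> real" where
  "dif [] f = f"
| "dif (h # hs) f = dif hs (\<lambda>x. f (x + h) - f x)"

lemma dif_add: "dif hs (\<lambda>x. f x + g x) y = dif hs f y + dif hs g y"
proof (induction hs arbitrary: f g)
  case (Cons h hs)
  show ?case
    using Cons[of "\<lambda>x. f (x + h) - f x" "\<lambda>x. g (x + h) - g x"] by (simp add: algebra_simps)
qed simp

lemma dif_cmult: "dif hs (\<lambda>x. c * f x) y = c * dif hs f y"
proof (induction hs arbitrary: f)
  case (Cons h hs)
  show ?case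
    using Cons[of "\<lambda>x. f (x + h) - f x"] by (simp add: algebra_simps)
qed simp

lemma dif_zero: "dif hs (\<lambda>x. 0) y = 0"
  using dif_cmult[of hs 0 "\<lambda>x. 0" y] by simp

lemma dif_sum: "dif hs (\<lambda>x. \<Sum>i\<in>I. f i x) y = (\<Sum>i\<in>I. dif hs (f i) y)"
  by (induction I rule: infinite_finite_induct) (simp_all add: dif_zero dif_add)

lemma dif_swap: "dif (a # b # hs) f = dif (b # a # hs) f"
  by (simp add: algebra_simps)

text \<open>
  Elements of \<open>Lip\<^sub>0(B)\<close> agree with polynomials on the ball only; small increments keep all
  evaluation points inside it.
\<close>

lemma dif_cong_ball:
  fixes f g :: "'a::real_normed_vector \<Rightarrow> real"
  assumes "\<And>z. norm z \<le> r \<Longrightarrow> f z = g z" "norm y + sum_list (map norm hs) \<le> r"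
  shows "dif hs f y = dif hs g y"
  using assms
proof (induction hs arbitrary: f g r)
  case (Cons h hs)
  show ?case
    unfolding dif.simps
  proof (rule Cons.IH[where r = "r - norm h"])
    fix z :: 'a assume "norm z \<le> r - norm h"
    then have "norm z \<le> r" "norm (z + h) \<le> r"
      using norm_triangle_ineq[of z h] norm_ge_zero[of h] by linarith+
    then show "f (z + h) - f z = g (z + h) - g z"
      using Cons.prems(1) by simp
  qed (use Cons.prems(2) in simp)
qed simp

lemma dif_bound:
  fixes f :: "'a::real_normed_vector \<Rightarrow> real"
  assumes "\<And>z. \<bar>f z\<bar> \<le> B"
  shows "\<bar>dif hs f y\<bar> \<le> 2 ^ length hs * B"
  using assms
proof (induction hs arbitrary: f B)
  case (Cons h hs)
  have "\<bar>f (z + h) - f z\<bar> \<le> 2 * B" for z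
    using Cons.prems[of z] Cons.prems[of "z + h"] by linarith
  from Cons.IH[OF this] show ?case by (simp add: mult_ac)
qed simp

text \<open>
  The defect of additivity \<open>\<Delta>\<^bsub>a+b\<^esub> f - \<Delta>\<^sub>a f - \<Delta>\<^sub>b f\<close> is the second difference \<open>\<Delta>\<^sub>b \<Delta>\<^sub>a f\<close>, which the
  remaining differences annihilate if \<open>f\<close> has low degree.
\<close>

lemma additive_dif:
  assumes "\<And>as y. length as = Suc (Suc (length hs)) \<Longrightarrow> dif as f y = 0"
  shows "Modules.additive (\<lambda>h. dif (h # hs) f y)"
proof
  fix a b
  let ?d = "\<lambda>h x. f (x + h) - f x"
  have "dif hs (\<lambda>x. ?d a (x + b) - ?d a x) y = 0"
    using assms[of "a # b # hs" y] by simp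
  moreover have "?d (a + b) = (\<lambda>x. (?d a (x + b) - ?d a x) + (?d a x + ?d b x))"
    by (auto simp: algebra_simps)
  ultimately show "dif ((a + b) # hs) f y = dif (a # hs) f y + dif (b # hs) f y"
    by (simp only: dif.simps dif_add)
qed

lemma additive_sign_sum:
  fixes F :: "'a::real_vector \<Rightarrow> real"
  assumes F: "Modules.additive F" and e: "\<And>i. i \<in> I \<Longrightarrow> e i = -1 \<or> e i = 1"
  shows "F (\<Sum>i\<in>I. e i *\<^sub>R v i) = (\<Sum>i\<in>I. e i * F (v i))"
proof -
  interpret Modules.additive F by (rule F)
  have "F (e i *\<^sub>R v i) = e i * F (v i)" if "i \<in> I" for i
    using e[OF that] minus by auto
  then show ?thesis
    by (simp add: sum)
qed

text \<open>
  The difference of \<open>x \<mapsto> M(x, \<dots>, x)\<close> is not of the same kind: some slots hold shifted copies of \<open>x\<close> and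
  one holds a constant. The induction on the degree therefore runs over all functions
  \<open>x \<mapsto> M(r\<^sub>1 x + c\<^sub>1, \<dots>, r\<^sub>j x + c\<^sub>j)\<close>; a pair \<open>(r, c)\<close> encodes a slot.
\<close>

definition affine_at :: "'a::real_vector \<Rightarrow> real \<times> 'a \<Rightarrow> 'a" where
  "affine_at x p = fst p *\<^sub>R x + snd p"

abbreviation active :: "(real \<times> 'a) list \<Rightarrow> nat" where
  "active l \<equiv> length (filter (\<lambda>p. fst p \<noteq> 0) l)"

lemma linear_slot:
  assumes "\<And>xs i. length xs = j \<Longrightarrow> i < j \<Longrightarrow> linear (\<lambda>y. M (xs[i := y]))"
    and "length as + Suc (length bs) = j"
  shows "linear (\<lambda>y. M (as @ y # bs))"
  using assms(1)[of "as @ undefined # bs" "length as"] assms(2) by simp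

text \<open>
  The degree is the number of slots that depend on \<open>x\<close>. Replacing \<open>x\<close> by \<open>x + h\<close> in one slot
  after the other writes \<open>\<Delta>\<^sub>h\<close> as a telescoping sum, in each term of which linearity has turned one such
  slot into the constant \<open>r h\<close>.
\<close>

lemma dif_multilinear:
  fixes M :: "'a::real_vector list \<Rightarrow> real"
  assumes M: "\<And>xs i. length xs = j \<Longrightarrow> i < j \<Longrightarrow> linear (\<lambda>y. M (xs[i := y]))"
  shows "length l = j \<Longrightarrow> active l \<le> d \<Longrightarrow> length hs = Suc d
    \<Longrightarrow> dif hs (\<lambda>x. M (map (affine_at x) l)) y = 0"
proof (induction d arbitrary: l hs y)
  case 0
  obtain h where hs: "hs = [h]"
    using 0 by (auto simp: length_Suc_conv)
  have eq: "map (affine_at (y + h)) l = map (affine_at y) l"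
    using 0 by (auto simp: affine_at_def filter_empty_conv)
  show ?case
    unfolding hs dif.simps eq by simp
next
  case (Suc d)
  obtain h gs where hs: "hs = h # gs" and gs: "length gs = Suc d"
    using Suc.prems by (auto simp: length_Suc_conv)
  let ?sh = "map (\<lambda>p. (fst p, fst p *\<^sub>R h + snd p))"
  have sh: "map (affine_at (x + h)) ps = map (affine_at x) (?sh ps)" for ps and x :: 'a
    by (simp add: affine_at_def algebra_simps)
  have act: "active (?sh ps) = active ps" for ps
    by (simp add: filter_map o_def)
  \<comment> \<open>Telescoping: the slots in \<open>as\<close> are already shifted, those in \<open>bs\<close> are not yet.\<close>
  have "dif gs (\<lambda>x. M (map (affine_at (x + h)) as @ map (affine_at x) bs)
      - M (map (affine_at x) (as @ bs))) y = 0" if "l = as @ bs" for as bs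
    using that
  proof (induction as arbitrary: bs rule: rev_induct)
    case Nil
    then show ?case by (simp add: dif_zero)
  next
    case (snoc p as)
    have len: "length as + Suc (length bs) = j"
      using snoc.prems Suc.prems by simp
    have lin: "linear (\<lambda>y. M (map (affine_at (x + h)) as @ y # map (affine_at x) bs))" for x :: 'a
      by (rule linear_slot[where j = j, OF M]) (use len in auto)
    have step: "M (map (affine_at (x + h)) (as @ [p]) @ map (affine_at x) bs)
        - M (map (affine_at x) ((as @ [p]) @ bs)) =
      M (map (affine_at x) (?sh as @ (0, fst p *\<^sub>R h) # bs)) +
      (M (map (affine_at (x + h)) as @ map (affine_at x) (p # bs))
        - M (map (affine_at x) (as @ p # bs)))" for x :: 'a
    proof -
      have "affine_at (x + h) p = fst p *\<^sub>R h + affine_at x p"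
        "affine_at x (0, fst p *\<^sub>R h) = fst p *\<^sub>R h"
        by (simp_all add: affine_at_def algebra_simps)
      then show ?thesis
        using linear_add[OF lin[of x], of "fst p *\<^sub>R h" "affine_at x p"]
        by (simp add: sh del: map_map)
    qed
    have "dif gs (\<lambda>x. M (map (affine_at x) (?sh as @ (0, fst p *\<^sub>R h) # bs))) y = 0"
    proof (cases "fst p = 0")
      case True
      have "M (map (affine_at x) (?sh as @ (0, fst p *\<^sub>R h) # bs)) = 0" for x
        using linear_0[OF lin[of x]] True by (simp add: sh affine_at_def o_def)
      then show ?thesis by (simp add: dif_zero)
    next
      case False
      then have "active (?sh as @ (0, fst p *\<^sub>R h) # bs) \<le> d"
        using Suc.prems snoc.prems act[of as] by simp
      then show ?thesis
        using len gs by (intro Suc.IH) auto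
    qed
    then show ?case
      unfolding step dif_add using snoc.IH[of "p # bs"] snoc.prems by simp
  qed
  from this[of l "[]"] show ?case
    by (simp add: hs)
qed

lemma dif_polys:
  assumes "P \<in> polys k" "length hs = Suc k"
  shows "dif hs P y = 0"
proof -
  obtain R where R: "\<And>j. j \<le> k \<Longrightarrow> R j \<in> hom_polys j" and P: "P = (\<lambda>x. \<Sum>j\<le>k. R j x)"
    using assms(1) by (auto simp: polys_def)
  have "dif hs (R j) y = 0" if j: "j \<le> k" for j
  proof -
    obtain M where M: "bounded_multilinear j M" and RM: "R j = (\<lambda>x. M (replicate j x))"
      using R[OF j] by (auto simp: hom_polys_def)
    have eq: "R j = (\<lambda>x. M (map (affine_at x) (replicate j (1, 0))))"
      by (simp add: RM affine_at_def)
    show ?thesis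
      unfolding eq using M j assms(2)
      by (intro dif_multilinear[where j = j and d = k]) (auto simp: bounded_multilinear_def)
  qed
  then show ?thesis
    unfolding P dif_sum by simp
qed

text \<open>
  An increment along \<open>h a\<close> changes only the factor \<open>\<psi> a\<close>, and by the constant \<open>t a\<close>: each difference strips
  one factor.
\<close>

lemma dif_monomial:
  assumes "distinct is" "\<And>i. i \<in> set is \<Longrightarrow> linear (\<psi> i)"
    and "\<And>i j. i \<in> set is \<Longrightarrow> j \<in> set is \<Longrightarrow> \<psi> i (h j) = (if i = j then t j else 0)"
  shows "dif (map h is) (\<lambda>x. \<Prod>i\<leftarrow>is. \<psi> i x) y = (\<Prod>i\<leftarrow>is. t i)"
  using assms
proof (induction "is")
  case (Cons a as)
  have "(\<Prod>i\<leftarrow>as. \<psi> i (x + h a)) = (\<Prod>i\<leftarrow>as. \<psi> i x)" for x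
  proof -
    have "map (\<lambda>i. \<psi> i (x + h a)) as = map (\<lambda>i. \<psi> i x) as"
      using Cons.prems by (auto simp: linear_add)
    then show ?thesis by (rule arg_cong)
  qed
  then have "(\<lambda>x. (\<Prod>i\<leftarrow>a # as. \<psi> i (x + h a)) - (\<Prod>i\<leftarrow>a # as. \<psi> i x))
      = (\<lambda>x. t a * (\<Prod>i\<leftarrow>as. \<psi> i x))"
    using Cons.prems by (simp add: linear_add algebra_simps)
  then show ?case
    using Cons by (simp add: dif_cmult)
qed simp

lemma monomial_in_hom_polys:
  fixes \<psi> :: "'i \<Rightarrow> 'a::real_normed_vector \<Rightarrow> real"
  assumes lin: "\<And>i. i \<in> set is \<Longrightarrow> linear (\<psi> i)"
    and le: "\<And>i x. i \<in> set is \<Longrightarrow> \<bar>\<psi> i x\<bar> \<le> norm x"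
  shows "(\<lambda>x. c * (\<Prod>i\<leftarrow>is. \<psi> i x)) \<in> hom_polys (length is)"
proof -
  define M where "M xs = c * prod_list (map2 \<psi> is xs)" for xs
  have "linear (\<lambda>y. M (xs[i := y]))" if "length xs = length is" "i < length is" for xs i
  proof -
    have "prod_list (map2 \<psi> js (ys[i := y]))
        = prod_list (map2 \<psi> (take i js) (take i ys)) * \<psi> (js ! i) y
          * prod_list (map2 \<psi> (drop (Suc i) js) (drop (Suc i) ys))"
      if "length ys = length js" "i < length js" for js ys y
      using that
    proof (induction i arbitrary: js ys)
      case 0
      then show ?case by (cases js; cases ys) auto
    next
      case (Suc i)
      then show ?case by (cases js; cases ys) (auto simp: mult_ac)
    qed
    note this[OF that]
    moreover have "linear (\<psi> (is ! i))"
      using lin that by simp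
    ultimately show ?thesis
      by (auto simp: M_def linear_iff algebra_simps)
  qed
  moreover have "\<bar>M xs\<bar> \<le> \<bar>c\<bar> * prod_list (map norm xs)" if "length xs = length is" for xs
  proof -
    have "\<bar>prod_list (map2 \<psi> is xs)\<bar> \<le> prod_list (map norm xs)"
      using that[symmetric] le
    proof (induction rule: list_induct2)
      case (Cons a as x xs)
      then show ?case
        using norm_ge_zero[of x] by (auto simp: abs_mult intro!: mult_mono)
    qed simp
    then show ?thesis
      by (simp add: M_def abs_mult mult_left_mono)
  qed
  ultimately have "bounded_multilinear (length is) M"
    by (auto simp: bounded_multilinear_def)
  moreover have "c * (\<Prod>i\<leftarrow>is. \<psi> i x) = M (replicate (length is) x)" for x
  proof -
    have "map2 \<psi> js (replicate (length js) x) = map (\<lambda>i. \<psi> i x) js" for js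
      by (induction js) auto
    then show ?thesis by (simp add: M_def)
  qed
  ultimately show ?thesis
    by (auto simp: hom_polys_def)
qed

(* From here on differences are handled through the laws above and not unfolded. *)
declare dif.simps(2) [simp del]

section \<open>The test functions\<close>

text \<open>
  Exchanging the factors one at a time; each of the mixed products that occur is at most \<open>\<Prod>c\<close>
  because all \<open>c i \<ge> 1\<close>.
\<close>

lemma prod_diff_le:
  fixes a b :: "'i \<Rightarrow> complex"
  assumes "finite A" "\<And>i. i \<in> A \<Longrightarrow> norm (a i) \<le> c i" "\<And>i. i \<in> A \<Longrightarrow> norm (b i) \<le> c i"
    "\<And>i. i \<in> A \<Longrightarrow> 1 \<le> c i"
  shows "norm (prod a A - prod b A) \<le> prod c A * (\<Sum>i\<in>A. norm (a i - b i))"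
  using assms
proof (induction A rule: finite_induct)
  case (insert x A)
  have c1: "1 \<le> prod c A"
    using insert.prems by (intro prod_ge_1) auto
  have na: "norm (prod a A) \<le> prod c A"
    unfolding prod_norm[symmetric] using insert.prems by (intro prod_mono) auto
  have cx: "1 \<le> c x" "norm (b x) \<le> c x"
    using insert.prems by auto
  have IH: "norm (prod a A - prod b A) \<le> prod c A * (\<Sum>i\<in>A. norm (a i - b i))"
    using insert by auto
  have "prod a (insert x A) - prod b (insert x A)
      = (a x - b x) * prod a A + b x * (prod a A - prod b A)"
    using insert.hyps by (simp add: algebra_simps)
  also have "norm \<dots> \<le> norm (a x - b x) * norm (prod a A) + norm (b x) * norm (prod a A - prod b A)"
    by (metis norm_mult norm_triangle_ineq)
  also have "\<dots> \<le> norm (a x - b x) * (c x * prod c A)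
      + c x * (prod c A * (\<Sum>i\<in>A. norm (a i - b i)))"
  proof (intro add_mono mult_mono cx IH mult_left_mono)
    show "norm (prod a A) \<le> c x * prod c A"
      using na mult_right_mono[OF cx(1), of "prod c A"] c1 by linarith
  qed (use cx in auto)
  finally show ?case
    using insert.hyps by (simp add: algebra_simps)
qed simp

lemma lip0_apply_sum: "lip0_apply (\<Sum>i\<in>I. f i) x = (\<Sum>i\<in>I. lip0_apply (f i) x)"
  by (induction I rule: infinite_finite_induct) (simp_all add: zero_lip0.rep_eq plus_lip0.rep_eq)

text \<open>
  A copy of \<open>\<ell>\<^sub>2\<^sup>n\<close> in the space with basis \<open>w\<close>, together with the coordinates \<open>\<psi>\<close> of a projection onto it.
  The scaling is such that all distortion is carried by \<open>K\<close>.
\<close>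

locale l2_system =
  fixes n :: nat and K :: real and w :: "nat \<Rightarrow> 'a::real_normed_vector"
    and \<psi> :: "nat \<Rightarrow> 'a \<Rightarrow> real"
  assumes lin: "\<And>i. i < n \<Longrightarrow> linear (\<psi> i)"
    and sq_le: "\<And>x. (\<Sum>i<n. (\<psi> i x)\<^sup>2) \<le> (norm x)\<^sup>2"
    and dual: "\<And>i j. i < n \<Longrightarrow> j < n \<Longrightarrow> \<psi> i (w j) = (if i = j then 1 else 0)"
    and upper: "\<And>c. norm (\<Sum>i<n. c i *\<^sub>R w i) \<le> K * L2_set c {..<n}"
begin

lemma abs_le: "i < n \<Longrightarrow> \<bar>\<psi> i x\<bar> \<le> norm x"
proof -
  assume "i < n"
  then have "(\<psi> i x)\<^sup>2 \<le> (\<Sum>i<n. (\<psi> i x)\<^sup>2)"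
    by (intro member_le_sum) auto
  then show ?thesis
    using sq_le[of x] abs_le_square_iff[of "\<psi> i x" "norm x"] by simp
qed

definition riesz :: "(nat \<Rightarrow> real) \<Rightarrow> 'a \<Rightarrow> complex" where
  "riesz \<epsilon> x = (\<Prod>j<n. 1 + \<i> * of_real (\<epsilon> j * \<psi> j x))"

abbreviation signs :: "(nat \<Rightarrow> real) set" where
  "signs \<equiv> PiE {..<n} (\<lambda>_. {-1, 1})"

text \<open>
  The point is that the bound on the product does not depend on \<open>n\<close>: its square is at most
  \<open>\<Prod>(1 + \<psi>\<^sub>j(x)\<^sup>2) \<le> exp (\<Sum>\<psi>\<^sub>j(x)\<^sup>2) \<le> e\<close>. The factor \<open>\<surd>n\<close> comes from comparing the \<open>\<ell>\<^sub>1\<close> norm of the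
  coordinates of \<open>x - y\<close> with their \<open>\<ell>\<^sub>2\<close> norm.
\<close>

lemma riesz_lipschitz:
  assumes \<epsilon>: "\<epsilon> \<in> signs" and x: "norm x \<le> 1" and y: "norm y \<le> 1"
  shows "norm (riesz \<epsilon> x - riesz \<epsilon> y) \<le> exp 1 * sqrt n * norm (x - y)"
proof -
  define a where "a x j = 1 + \<i> * complex_of_real (\<epsilon> j * \<psi> j x)" for x j
  have e2: "(\<epsilon> j)\<^sup>2 = 1" if "j < n" for j
    using PiE_mem[OF \<epsilon>, of j] that by auto
  have na: "norm (a x j) = sqrt (1 + (\<psi> j x)\<^sup>2)" if "j < n" for x j
    using e2[OF that] by (simp add: a_def cmod_def power_mult_distrib)
  have na1: "1 \<le> norm (a x j)" if "j < n" for x j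
    by (simp add: na[OF that])
  have pa: "(\<Prod>j<n. norm (a x j)) \<le> exp (1/2)" if "norm x \<le> 1" for x
  proof (rule power2_le_imp_le)
    have "(\<Prod>j<n. norm (a x j))\<^sup>2 = (\<Prod>j<n. 1 + (\<psi> j x)\<^sup>2)"
      unfolding prod_power_distrib by (intro prod.cong) (auto simp: na)
    also have "\<dots> \<le> (\<Prod>j<n. exp ((\<psi> j x)\<^sup>2))"
      by (intro prod_mono) (auto intro: exp_ge_add_one_self)
    also have "\<dots> = exp (\<Sum>j<n. (\<psi> j x)\<^sup>2)"
      by (simp add: exp_sum)
    also have "\<dots> \<le> exp 1"
      using order_trans[OF sq_le[of x] power_le_one[of "norm x" 2]] that by simp
    finally show "(\<Prod>j<n. norm (a x j))\<^sup>2 \<le> (exp (1/2))\<^sup>2"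
      by (simp add: power2_eq_square exp_add[symmetric])
  qed simp
  have "norm (riesz \<epsilon> x - riesz \<epsilon> y)
      \<le> (\<Prod>j<n. norm (a x j) * norm (a y j)) * (\<Sum>j<n. norm (a x j - a y j))"
    unfolding riesz_def a_def[symmetric]
    \<comment> \<open>All factors have modulus at least 1, so the product of two of them dominates both.\<close>
  proof (rule prod_diff_le)
    fix j assume "j \<in> {..<n}"
    then have "1 \<le> norm (a x j)" "1 \<le> norm (a y j)"
      using na1 by auto
    then show "norm (a x j) \<le> norm (a x j) * norm (a y j)"
      "norm (a y j) \<le> norm (a x j) * norm (a y j)" "1 \<le> norm (a x j) * norm (a y j)"
      using mult_mono[of 1 "norm (a x j)" 1 "norm (a y j)"]
        mult_left_mono[of 1 "norm (a y j)" "norm (a x j)"]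
        mult_right_mono[of 1 "norm (a x j)" "norm (a y j)"] by auto
  qed simp
  also have "(\<Prod>j<n. norm (a x j) * norm (a y j)) \<le> exp (1/2) * exp (1/2)"
    unfolding prod.distrib using pa x y by (intro mult_mono prod_nonneg) auto
  also have "exp (1/2) * exp (1/2) = exp (1::real)"
    by (simp add: exp_add[symmetric])
  also have "(\<Sum>j<n. norm (a x j - a y j)) = (\<Sum>j<n. \<bar>\<psi> j (x - y)\<bar> * \<bar>1\<bar>)"
  proof (rule sum.cong)
    fix j assume "j \<in> {..<n}"
    then have j: "j < n" by simp
    have "a x j - a y j = \<i> * of_real (\<epsilon> j * \<psi> j (x - y))"
      unfolding linear_diff[OF lin[OF j]] by (simp add: a_def algebra_simps)
    moreover have "\<bar>\<epsilon> j\<bar> = 1"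
      using e2[OF j] by (auto simp: power2_eq_1_iff)
    ultimately show "norm (a x j - a y j) = \<bar>\<psi> j (x - y)\<bar> * \<bar>1\<bar>"
      by (simp add: norm_mult abs_mult)
  qed simp
  also have "\<dots> \<le> L2_set (\<lambda>j. \<psi> j (x - y)) {..<n} * L2_set (\<lambda>j. 1) {..<n}"
    by (rule L2_set_mult_ineq)
  also have "L2_set (\<lambda>j. \<psi> j (x - y)) {..<n} \<le> norm (x - y)"
    using sq_le[of "x - y"] by (simp add: L2_set_def real_le_lsqrt sum_nonneg)
  also have "L2_set (\<lambda>j. 1) {..<n} = sqrt n"
    by (simp add: L2_set_def)
  finally show ?thesis
    by (simp add: mult_ac mult_left_mono mult_right_mono sum_nonneg)
qed

text \<open>
  The factor \<open>(-\<i>)\<^sup>k\<close> makes the coefficients of the monomials of degree \<open>k\<close> real and positive;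
  subtracting \<open>1\<close> makes the function vanish at \<open>0\<close>.
\<close>

definition test :: "nat \<Rightarrow> (nat \<Rightarrow> real) \<Rightarrow> 'a \<Rightarrow> real" where
  "test k \<epsilon> x = Re ((-\<i>) ^ k * (riesz \<epsilon> x - 1))"

lemma test_lip0:
  assumes \<epsilon>: "\<epsilon> \<in> signs"
  shows "\<exists>f. norm f \<le> exp 1 * sqrt n \<and> (\<forall>x\<in>cball 0 1. lip0_apply f x = test k \<epsilon> x)"
proof -
  let ?f = "\<lambda>x. if x \<in> cball 0 1 then test k \<epsilon> x else 0"
  have lip: "(exp 1 * sqrt n)-lipschitz_on (cball 0 1) ?f"
  proof (rule lipschitz_onI)
    fix x y :: 'a assume xy: "x \<in> cball 0 1" "y \<in> cball 0 1"
    have "\<bar>test k \<epsilon> x - test k \<epsilon> y\<bar> = \<bar>Re ((-\<i>) ^ k * (riesz \<epsilon> x - riesz \<epsilon> y))\<bar>"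
      by (simp add: test_def algebra_simps)
    also have "\<dots> \<le> norm ((-\<i>) ^ k * (riesz \<epsilon> x - riesz \<epsilon> y))"
      by (rule abs_Re_le_cmod)
    also have "\<dots> = norm (riesz \<epsilon> x - riesz \<epsilon> y)"
      by (simp add: norm_mult norm_power)
    also have "\<dots> \<le> exp 1 * sqrt n * norm (x - y)"
      using xy by (intro riesz_lipschitz \<epsilon>) auto
    finally show "dist (?f x) (?f y) \<le> exp 1 * sqrt n * dist x y"
      using xy by (simp add: dist_norm)
  qed simp
  have "riesz \<epsilon> 0 = 1"
    using linear_0[OF lin] by (simp add: riesz_def)
  then have "?f \<in> lip0_set"
    using lip by (auto simp: lip0_set_def test_def)
  then have "lip0_apply (Abs_lip0 ?f) = ?f"
    by (rule Abs_lip0_inverse)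
  then show ?thesis
    using lip norm_lip0_le[of "exp 1 * sqrt n" "Abs_lip0 ?f"] by (intro exI[of _ "Abs_lip0 ?f"]) auto
qed

text \<open>
  The sum over all sign vectors of a product over the coordinates is the product over the coordinates of
  sums over one sign. With the extra factor \<open>\<epsilon>\<^sub>j\<close> for \<open>j \<in> S\<close>, the sum over \<open>\<epsilon>\<^sub>j\<close> keeps the odd part
  \<open>2\<i>\<psi>\<^sub>j\<close> of a factor, and without it the even part \<open>2\<close>.
\<close>

lemma test_component:
  assumes S: "S \<subseteq> {..<n}" "card S = k" "k > 0"
  shows "(\<Sum>\<epsilon>\<in>signs. (\<Prod>i\<in>S. \<epsilon> i) * test k \<epsilon> x) = 2 ^ n * (\<Prod>i\<in>S. \<psi> i x)"
proof -
  let ?r = "complex_of_real"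
  have fS: "finite S" and ne: "S \<noteq> {}"
    using S finite_subset by auto
  have cS: "(\<Prod>j<n. if j \<in> S then g j else h j) = prod g S * prod h ({..<n} - S)"
    for g h :: "nat \<Rightarrow> complex"
  proof -
    have "{..<n} \<inter> {j. j \<in> S} = S" "{..<n} \<inter> - {j. j \<in> S} = {..<n} - S"
      using S(1) by auto
    then show ?thesis
      using prod.If_cases[of "{..<n}" "\<lambda>j. j \<in> S" g h] by simp
  qed
  have sgn: "(\<Prod>i\<in>S. ?r (\<epsilon> i)) = (\<Prod>j<n. if j \<in> S then ?r (\<epsilon> j) else 1)" for \<epsilon> :: "nat \<Rightarrow> real"
    by (simp add: cS)
  have "(\<Sum>\<epsilon>\<in>signs. (\<Prod>i\<in>S. ?r (\<epsilon> i)) * riesz \<epsilon> x)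
      = (\<Sum>\<epsilon>\<in>signs. \<Prod>j<n. (if j \<in> S then ?r (\<epsilon> j) else 1) * (1 + \<i> * ?r (\<epsilon> j * \<psi> j x)))"
    by (simp only: sgn riesz_def prod.distrib)
  also have "\<dots> = (\<Prod>j<n. \<Sum>e\<in>{-1, 1}. (if j \<in> S then ?r e else 1) * (1 + \<i> * ?r (e * \<psi> j x)))"
    by (rule prod_sum_PiE[symmetric]) auto
  also have "\<dots> = (\<Prod>j<n. if j \<in> S then 2 * (\<i> * ?r (\<psi> j x)) else 2)"
    by (intro prod.cong) (auto simp: algebra_simps)
  also have "\<dots> = 2 ^ card S * (\<i> ^ card S * (\<Prod>j\<in>S. ?r (\<psi> j x))) * 2 ^ card ({..<n} - S)"
    by (simp add: cS prod.distrib)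
  also have "\<dots> = 2 ^ n * \<i> ^ k * (\<Prod>j\<in>S. ?r (\<psi> j x))"
  proof -
    have "card S + card ({..<n} - S) = n"
      using S(1) fS card_mono[OF _ S(1)] by (simp add: card_Diff_subset)
    then have "(2::complex) ^ n = 2 ^ card S * 2 ^ card ({..<n} - S)"
      by (metis power_add)
    then show ?thesis
      by (simp add: S(2) mult_ac)
  qed
  finally have 1: "(\<Sum>\<epsilon>\<in>signs. (\<Prod>i\<in>S. ?r (\<epsilon> i)) * riesz \<epsilon> x)
      = 2 ^ n * \<i> ^ k * (\<Prod>j\<in>S. ?r (\<psi> j x))" .
  have "(\<Sum>\<epsilon>\<in>signs. (\<Prod>i\<in>S. ?r (\<epsilon> i))) = (\<Prod>j<n. \<Sum>e\<in>{-1, 1}. if j \<in> S then ?r e else 1)"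
    unfolding sgn by (rule prod_sum_PiE[symmetric]) auto
  also have "\<dots> = 0"
    using ne S(1) by auto
  finally have 2: "(\<Sum>\<epsilon>\<in>signs. (\<Prod>i\<in>S. ?r (\<epsilon> i))) = 0" .
  define c where "c = (-\<i>) ^ k"
  have cancel: "c * \<i> ^ k = 1"
    by (simp add: c_def flip: power_mult_distrib)
  have summand: "(\<Prod>i\<in>S. \<epsilon> i) * test k \<epsilon> x
      = Re (c * ((\<Prod>i\<in>S. ?r (\<epsilon> i)) * riesz \<epsilon> x) - c * (\<Prod>i\<in>S. ?r (\<epsilon> i)))" for \<epsilon>
  proof -
    have Re_mult: "p * Re z = Re (?r p * z)" for p z
      by simp
    have "c * (?r p * z) - c * ?r p = ?r p * (c * (z - 1))" for p z
      by (simp add: algebra_simps)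
    then show ?thesis
      by (simp only: test_def c_def[symmetric] of_real_prod[symmetric] Re_mult)
  qed
  have "(\<Sum>\<epsilon>\<in>signs. (\<Prod>i\<in>S. \<epsilon> i) * test k \<epsilon> x)
      = Re (c * (\<Sum>\<epsilon>\<in>signs. (\<Prod>i\<in>S. ?r (\<epsilon> i)) * riesz \<epsilon> x)
        - c * (\<Sum>\<epsilon>\<in>signs. (\<Prod>i\<in>S. ?r (\<epsilon> i))))"
    by (simp only: summand Re_sum[symmetric] sum_subtractf sum_distrib_left[symmetric])
  also have "\<dots> = Re (c * (2 ^ n * \<i> ^ k * (\<Prod>j\<in>S. ?r (\<psi> j x))))"
    by (simp only: 1 2 mult_zero_right diff_zero)
  also have "c * (2 ^ n * \<i> ^ k * (\<Prod>j\<in>S. ?r (\<psi> j x)))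
      = (c * \<i> ^ k) * (2 ^ n * (\<Prod>j\<in>S. ?r (\<psi> j x)))"
    by (simp only: mult_ac)
  also have "\<dots> = ?r (2 ^ n * (\<Prod>j\<in>S. \<psi> j x))"
    by (simp add: cancel)
  finally show ?thesis
    by (simp only: Re_complex_of_real)
qed

section \<open>The lower bound for the norm of a projection\<close>

lemma block_norm:
  assumes A: "A \<subseteq> {..<n}" and c: "\<And>i. i \<in> A \<Longrightarrow> \<bar>c i\<bar> = r" and r: "0 \<le> r"
  shows "norm (\<Sum>i\<in>A. c i *\<^sub>R w i) \<le> K * (r * sqrt (card A))"
proof -
  have fA: "finite A"
    using A finite_subset by auto
  let ?c = "\<lambda>i. if i \<in> A then c i else 0"
  have sq: "(c i)\<^sup>2 = r\<^sup>2" if "i \<in> A" for i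
    using c[OF that] by (metis power2_abs)
  have "(\<Sum>i<n. ?c i *\<^sub>R w i) = (\<Sum>i\<in>A. c i *\<^sub>R w i)"
    using A by (intro sum.mono_neutral_cong_right) auto
  moreover have "(\<Sum>i<n. (?c i)\<^sup>2) = (\<Sum>i\<in>A. r\<^sup>2)"
    using A by (intro sum.mono_neutral_cong_right) (auto simp: sq)
  then have "L2_set ?c {..<n} = r * sqrt (card A)"
    using r by (simp add: L2_set_def real_sqrt_mult)
  ultimately show ?thesis
    using upper[of ?c] by simp
qed

text \<open>
  Take the increments \<open>a\<^sub>\<epsilon> = t N\<^sup>-\<^sup>1\<^sup>/\<^sup>2 \<Sum>\<^bsub>i<N\<^esub> \<epsilon>\<^sub>i w\<^sub>i\<close>, the analogous \<open>b\<^sub>\<epsilon>\<close> over \<open>N \<le> j < 2N\<close>, and \<open>t w\<^sub>l\<close> for the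
  remaining \<open>k - 2\<close> indices \<open>l\<close>. All have norm at most \<open>tK \<le> 1/k\<close>, so the \<open>k\<close>-fold difference of \<open>Q f\<^sub>\<epsilon>\<close> at \<open>0\<close> only
  uses points of the ball and is at most \<open>2\<^sup>k \<parallel>Q\<parallel> \<parallel>f\<^sub>\<epsilon>\<parallel>\<close>, of order \<open>\<surd>n\<close>. Expanding it by additivity, multiplying by the signs of the
  remaining indices and summing over \<open>\<epsilon>\<close> turns the term of \<open>(i, j)\<close> into the difference of
  \<open>Q\<close> applied to \<open>2\<^sup>n\<close> times the monomial of \<open>S = {i, j} \<union> {2N..<n}\<close>, which is \<open>2\<^sup>n t\<^sup>k / N\<close>. There are
  \<open>N\<^sup>2\<close> such terms.
\<close>

lemma projection_estimate:
  fixes Q :: "'a lip0 \<Rightarrow> 'a lip0"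
  assumes k: "k \<ge> 2" and n: "n = 2 * N + (k - 2)" and N: "N \<ge> 1"
    and Q: "bounded_linear Q" "\<And>f. Q f \<in> restrictions (polys k)"
      "\<And>f. f \<in> restrictions (hom_polys k) \<Longrightarrow> Q f = f"
    and t: "0 < t" "k * (t * K) \<le> 1"
  shows "t ^ k * N \<le> 2 ^ k * (onorm Q * (exp 1 * sqrt n))"
proof -
  define \<mu> where "\<mu> = t / sqrt N"
  define A B where "A = {..<N}" and "B = {N..<2 * N}"
  define ext where "ext = [2 * N..<n]"
  define hs where "hs = map (\<lambda>i. t *\<^sub>R w i) ext"
  have AB: "A \<subseteq> {..<n}" "B \<subseteq> {..<n}" "set ext \<subseteq> {..<n}"
    by (auto simp: A_def B_def ext_def n)
  have len: "length hs = k - 2"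
    by (simp add: hs_def ext_def n)
  have \<mu>0: "0 \<le> \<mu>" and \<mu>t: "\<mu> \<le> t"
    using t N by (auto simp: \<mu>_def divide_le_eq mult_le_cancel_left1)
  have w_le: "norm (r *\<^sub>R w i) \<le> t * K" if "i < n" "0 \<le> r" "r \<le> t" for i r
  proof -
    have K0: "0 \<le> K"
      using order_trans[OF norm_ge_zero block_norm[of "{i}" "\<lambda>_. 1" 1]] that by simp
    have "norm (r *\<^sub>R w i) \<le> K * r"
      using block_norm[of "{i}" "\<lambda>_. r" r] that by simp
    also have "\<dots> \<le> t * K"
      using that K0 by (simp add: mult.commute mult_left_mono)
    finally show ?thesis .
  qed
  have sum_norm: "sum_list (map norm (a # b # hs)) \<le> 1" if "norm a \<le> t * K" "norm b \<le> t * K" for a b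
  proof -
    have "sum_list (map norm (a # b # hs)) \<le> sum_list (map (\<lambda>_. t * K) (a # b # hs))"
      using that w_le[where r = t] t AB by (intro sum_list_mono) (auto simp: hs_def)
    also have "\<dots> = k * (t * K)"
      using k len by (simp add: sum_list_triv of_nat_diff algebra_simps)
    finally show ?thesis using t by simp
  qed

  obtain f where f: "\<And>\<epsilon>. \<epsilon> \<in> signs \<Longrightarrow> norm (f \<epsilon>) \<le> exp 1 * sqrt n"
    "\<And>\<epsilon> x. \<epsilon> \<in> signs \<Longrightarrow> x \<in> cball 0 1 \<Longrightarrow> lip0_apply (f \<epsilon>) x = test k \<epsilon> x"
    using test_lip0[where k = k] by metis
  have "\<exists>P. \<forall>\<epsilon>. P \<epsilon> \<in> polys k \<and> (\<forall>x\<in>cball 0 1. lip0_apply (Q (f \<epsilon>)) x = P \<epsilon> x)"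
    using Q(2) unfolding restrictions_def by (intro choice) blast
  then obtain P where P: "\<And>\<epsilon>. P \<epsilon> \<in> polys k"
    "\<And>\<epsilon> x. x \<in> cball 0 1 \<Longrightarrow> lip0_apply (Q (f \<epsilon>)) x = P \<epsilon> x"
    by blast
  define a where "a \<epsilon> = (\<Sum>i\<in>A. \<epsilon> i *\<^sub>R (\<mu> *\<^sub>R w i))" for \<epsilon> :: "nat \<Rightarrow> real"
  define b where "b \<epsilon> = (\<Sum>j\<in>B. \<epsilon> j *\<^sub>R (\<mu> *\<^sub>R w j))" for \<epsilon> :: "nat \<Rightarrow> real"
  have sgn: "\<epsilon> i = -1 \<or> \<epsilon> i = 1" if "\<epsilon> \<in> signs" "i < n" for \<epsilon> i
    using PiE_mem[OF that(1), of i] that(2) by simp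
  have block: "norm (\<Sum>i\<in>I. \<epsilon> i *\<^sub>R (\<mu> *\<^sub>R w i)) \<le> t * K"
    if "\<epsilon> \<in> signs" "I \<subseteq> {..<n}" "card I = N" for \<epsilon> I
  proof -
    have "norm (\<Sum>i\<in>I. (\<epsilon> i * \<mu>) *\<^sub>R w i) \<le> K * (\<mu> * sqrt (card I))"
      using sgn[OF that(1)] that(2) \<mu>0 by (intro block_norm) (fastforce simp: abs_mult)+
    then show ?thesis
      using N that(3) by (simp add: \<mu>_def mult.commute)
  qed
  have ab: "norm (a \<epsilon>) \<le> t * K" "norm (b \<epsilon>) \<le> t * K" if "\<epsilon> \<in> signs" for \<epsilon>
    using block[OF that AB(1)] block[OF that AB(2)]
    by (simp_all add: a_def b_def A_def B_def del: scaleR_scaleR)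

  have on_ball: "dif (u # v # hs) (P \<epsilon>) 0 = dif (u # v # hs) (lip0_apply (Q (f \<epsilon>))) 0"
    if "norm u \<le> t * K" "norm v \<le> t * K" for u v \<epsilon>
    using P(2) sum_norm[OF that] by (intro dif_cong_ball[where r = 1]) auto

  have bound: "\<bar>dif (a \<epsilon> # b \<epsilon> # hs) (P \<epsilon>) 0\<bar> \<le> 2 ^ k * (onorm Q * (exp 1 * sqrt n))"
    if "\<epsilon> \<in> signs" for \<epsilon>
  proof -
    have "\<bar>dif (a \<epsilon> # b \<epsilon> # hs) (lip0_apply (Q (f \<epsilon>))) 0\<bar>
        \<le> 2 ^ length (a \<epsilon> # b \<epsilon> # hs) * norm (Q (f \<epsilon>))"
      by (intro dif_bound lip0_apply_le)
    also have "length (a \<epsilon> # b \<epsilon> # hs) = k"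
      using k len by simp
    also have "norm (Q (f \<epsilon>)) \<le> onorm Q * norm (f \<epsilon>)"
      by (rule onorm[OF Q(1)])
    also have "\<dots> \<le> onorm Q * (exp 1 * sqrt n)"
      by (intro mult_left_mono f(1) that onorm_pos_le Q(1))
    finally show ?thesis
      using on_ball[OF ab[OF that]] by simp
  qed

  have expand: "dif (a \<epsilon> # b \<epsilon> # hs) (P \<epsilon>) 0
      = (\<Sum>i\<in>A. \<Sum>j\<in>B. \<epsilon> i * \<epsilon> j * dif (\<mu> *\<^sub>R w i # \<mu> *\<^sub>R w j # hs) (P \<epsilon>) 0)"
    if \<epsilon>: "\<epsilon> \<in> signs" for \<epsilon>
  proof -
    have add1: "Modules.additive (\<lambda>h. dif (h # v # hs) (P \<epsilon>) 0)" for v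
      by (rule additive_dif, rule dif_polys[OF P(1)]) (use k len in simp)
    have add2: "Modules.additive (\<lambda>h. dif (v # h # hs) (P \<epsilon>) 0)" for v
      using add1[of v] by (simp only: dif_swap[of _ v])
    have "dif (a \<epsilon> # b \<epsilon> # hs) (P \<epsilon>) 0
        = (\<Sum>i\<in>A. \<epsilon> i * dif (\<mu> *\<^sub>R w i # b \<epsilon> # hs) (P \<epsilon>) 0)"
      unfolding a_def using sgn[OF \<epsilon>] AB by (intro additive_sign_sum[OF add1]) auto
    also have "\<dots> = (\<Sum>i\<in>A. \<epsilon> i * (\<Sum>j\<in>B. \<epsilon> j * dif (\<mu> *\<^sub>R w i # \<mu> *\<^sub>R w j # hs) (P \<epsilon>) 0))"
      unfolding b_def using sgn[OF \<epsilon>] AB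
      by (intro sum.cong refl arg_cong2[where f = times] additive_sign_sum[OF add2]) auto
    finally show ?thesis
      by (simp add: sum_distrib_left mult.assoc)
  qed

  have component: "(\<Sum>\<epsilon>\<in>signs. (\<Prod>i\<leftarrow>i # j # ext. \<epsilon> i) *
      dif (\<mu> *\<^sub>R w i # \<mu> *\<^sub>R w j # hs) (P \<epsilon>) 0) = 2 ^ n * (t ^ k / N)"
    if ij: "i \<in> A" "j \<in> B" for i j
  proof -
    let ?is = "i # j # ext" and ?hs = "\<mu> *\<^sub>R w i # \<mu> *\<^sub>R w j # hs"
    have ist: "distinct ?is" "set ?is \<subseteq> {..<n}" "length ?is = k"
      using ij AB k by (auto simp: A_def B_def ext_def n)
    have small: "norm (\<mu> *\<^sub>R w i) \<le> t * K" "norm (\<mu> *\<^sub>R w j) \<le> t * K"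
    proof -
      have "i < n" "j < n"
        using ij AB by auto
      then show "norm (\<mu> *\<^sub>R w i) \<le> t * K" "norm (\<mu> *\<^sub>R w j) \<le> t * K"
        using \<mu>0 \<mu>t by (intro w_le; simp)+
    qed
    have prods: "(\<Prod>l\<leftarrow>?is. c l) = (\<Prod>l\<in>set ?is. c l)" for c :: "nat \<Rightarrow> real"
      using prod.distinct_set_conv_list[OF ist(1), of c] by simp
    have hs_eq: "?hs = map (\<lambda>l. (if l < 2 * N then \<mu> else t) *\<^sub>R w l) ?is"
      using ij by (auto simp: A_def B_def hs_def ext_def)
    define g where "g = (\<Sum>\<epsilon>\<in>signs. (\<Prod>l\<leftarrow>?is. \<epsilon> l) *\<^sub>R f \<epsilon>)"
    have g: "lip0_apply g x = 2 ^ n * (\<Prod>l\<leftarrow>?is. \<psi> l x)" if "norm x \<le> 1" for x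
    proof -
      have "lip0_apply g x = (\<Sum>\<epsilon>\<in>signs. (\<Prod>l\<leftarrow>?is. \<epsilon> l) * test k \<epsilon> x)"
        unfolding g_def lip0_apply_sum scaleR_lip0.rep_eq
        using f(2) that by (intro sum.cong) auto
      also have "\<dots> = 2 ^ n * (\<Prod>l\<in>set ?is. \<psi> l x)"
        unfolding prods using ist k distinct_card[OF ist(1)] by (intro test_component) auto
      finally show ?thesis
        by (simp only: prods)
    qed
    have "(\<lambda>x. 2 ^ n * (\<Prod>l\<leftarrow>?is. \<psi> l x)) \<in> hom_polys (length ?is)"
      using ist(2) lin abs_le by (intro monomial_in_hom_polys) auto
    then have "g \<in> restrictions (hom_polys k)"
      unfolding restrictions_def ist(3) using g by auto
    then have "g = Q g"
      using Q(3) by simp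
    also have "Q g = (\<Sum>\<epsilon>\<in>signs. (\<Prod>l\<leftarrow>?is. \<epsilon> l) *\<^sub>R Q (f \<epsilon>))"
      unfolding g_def using bounded_linear.linear[OF Q(1)] by (simp add: linear_sum linear_scale)
    finally have gQ: "lip0_apply g = (\<lambda>x. \<Sum>\<epsilon>\<in>signs. (\<Prod>l\<leftarrow>?is. \<epsilon> l) * lip0_apply (Q (f \<epsilon>)) x)"
      by (simp add: fun_eq_iff lip0_apply_sum scaleR_lip0.rep_eq)
    have "(\<Sum>\<epsilon>\<in>signs. (\<Prod>l\<leftarrow>?is. \<epsilon> l) * dif ?hs (P \<epsilon>) 0) = dif ?hs (lip0_apply g) 0"
      unfolding gQ dif_sum dif_cmult using on_ball[OF small] by simp
    also have "\<dots> = dif ?hs (\<lambda>x. 2 ^ n * (\<Prod>l\<leftarrow>?is. \<psi> l x)) 0"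
      using g sum_norm[OF small] by (intro dif_cong_ball[where r = 1]) auto
    also have "\<dots> = 2 ^ n * dif ?hs (\<lambda>x. \<Prod>l\<leftarrow>?is. \<psi> l x) 0"
      by (rule dif_cmult)
    also have "dif ?hs (\<lambda>x. \<Prod>l\<leftarrow>?is. \<psi> l x) 0 = (\<Prod>l\<leftarrow>?is. if l < 2 * N then \<mu> else t)"
      unfolding hs_eq
    proof (rule dif_monomial)
      fix l m assume "l \<in> set ?is" "m \<in> set ?is"
      then have "l < n" "m < n"
        using ist(2) by auto
      then show "\<psi> l ((if m < 2 * N then \<mu> else t) *\<^sub>R w m)
          = (if l = m then if m < 2 * N then \<mu> else t else 0)"
        by (simp add: linear_scale[OF lin] dual)
    qed (use ist lin in auto)
    also have "\<dots> = \<mu> * (\<mu> * (\<Prod>l\<leftarrow>ext. t))"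
    proof -
      have "map (\<lambda>l. if l < 2 * N then \<mu> else t) ext = map (\<lambda>l. t) ext"
        by (auto simp: ext_def)
      then show ?thesis
        using ij by (simp add: A_def B_def del: map_eq_conv)
    qed
    also have "(\<Prod>l\<leftarrow>ext. t) = t ^ (k - 2)"
      using len by (simp add: hs_def map_replicate_const)
    also have "\<mu> * (\<mu> * t ^ (k - 2)) = t ^ k / N"
    proof -
      obtain j where "k = 2 + j"
        using k le_Suc_ex by blast
      then show ?thesis
        by (simp add: \<mu>_def)
    qed
    finally show ?thesis .
  qed

  have "2 ^ n * (t ^ k * N) = (\<Sum>i\<in>A. \<Sum>j\<in>B. 2 ^ n * (t ^ k / N))"
    using N by (simp add: A_def B_def)
  also have "\<dots> = (\<Sum>i\<in>A. \<Sum>j\<in>B. \<Sum>\<epsilon>\<in>signs. (\<Prod>i\<leftarrow>i # j # ext. \<epsilon> i) *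
      dif (\<mu> *\<^sub>R w i # \<mu> *\<^sub>R w j # hs) (P \<epsilon>) 0)"
    by (intro sum.cong refl component[symmetric])
  also have "\<dots> = (\<Sum>i\<in>A. \<Sum>\<epsilon>\<in>signs. \<Sum>j\<in>B. (\<Prod>i\<leftarrow>i # j # ext. \<epsilon> i) *
      dif (\<mu> *\<^sub>R w i # \<mu> *\<^sub>R w j # hs) (P \<epsilon>) 0)"
    by (rule sum.cong[OF refl], rule sum.swap)
  also have "\<dots> = (\<Sum>\<epsilon>\<in>signs. \<Sum>i\<in>A. \<Sum>j\<in>B. (\<Prod>i\<leftarrow>i # j # ext. \<epsilon> i) *
      dif (\<mu> *\<^sub>R w i # \<mu> *\<^sub>R w j # hs) (P \<epsilon>) 0)"
    by (rule sum.swap)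
  also have "\<dots> = (\<Sum>\<epsilon>\<in>signs. (\<Prod>i\<leftarrow>ext. \<epsilon> i) * dif (a \<epsilon> # b \<epsilon> # hs) (P \<epsilon>) 0)"
    by (rule sum.cong[OF refl], simp only: expand sum_distrib_left list.map prod_list.Cons mult.assoc)
      (simp only: mult.left_commute mult.commute)
  also have "\<dots> \<le> (\<Sum>\<epsilon>\<in>signs. 2 ^ k * (onorm Q * (exp 1 * sqrt n)))"
  proof (rule sum_mono)
    fix \<epsilon> assume \<epsilon>: "\<epsilon> \<in> signs"
    have "\<bar>\<Prod>i\<leftarrow>is. \<epsilon> i\<bar> = 1" if "set is \<subseteq> {..<n}" for "is"
      using that
    proof (induction "is")
      case (Cons i "is")
      then show ?case using sgn[OF \<epsilon>, of i] by (auto simp: abs_mult)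
    qed simp
    from this[OF AB(3)]
    have "(\<Prod>i\<leftarrow>ext. \<epsilon> i) * dif (a \<epsilon> # b \<epsilon> # hs) (P \<epsilon>) 0
        \<le> \<bar>dif (a \<epsilon> # b \<epsilon> # hs) (P \<epsilon>) 0\<bar>"
      using abs_ge_self[of "(\<Prod>i\<leftarrow>ext. \<epsilon> i) * dif (a \<epsilon> # b \<epsilon> # hs) (P \<epsilon>) 0"]
      by (simp add: abs_mult)
    with bound[OF \<epsilon>] show "(\<Prod>i\<leftarrow>ext. \<epsilon> i) * dif (a \<epsilon> # b \<epsilon> # hs) (P \<epsilon>) 0
        \<le> 2 ^ k * (onorm Q * (exp 1 * sqrt n))"
      by linarith
  qed
  also have "\<dots> = 2 ^ n * (2 ^ k * (onorm Q * (exp 1 * sqrt n)))"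
    by (simp add: card_PiE)
  finally show ?thesis
    by simp
qed

end

section \<open>Coordinates from complemented copies of \<open>\<ell>\<^sub>2\<^sup>n\<close>\<close>

lemma ell2_iso_sum:
  assumes T: "ell2_iso n T F"
  shows "T (\<lambda>i. if i < n then c i else 0) = (\<Sum>i<n. c i *\<^sub>R T (\<lambda>j. if j = i then 1 else 0))"
proof -
  have add: "T (\<lambda>i. c i + d i) = T c + T d" if "c \<in> ell2 n" "d \<in> ell2 n" for c d
    using T that by (auto simp: ell2_iso_def)
  have scale: "T (\<lambda>i. r * c i) = r *\<^sub>R T c" if "c \<in> ell2 n" for r c
    using T that by (auto simp: ell2_iso_def)
  have zero: "T (\<lambda>_. 0) = 0"
    using scale[of "\<lambda>_. 0" 0] by (simp add: ell2_def)
  have "m \<le> n \<Longrightarrow> T (\<lambda>i. if i < m then c i else 0)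
      = (\<Sum>i<m. c i *\<^sub>R T (\<lambda>j. if j = i then 1 else 0))" for m
  proof (induction m)
    case (Suc m)
    let ?e = "\<lambda>j. if j = m then 1 else 0 :: real"
    have e: "?e \<in> ell2 n"
      using Suc by (auto simp: ell2_def)
    have "(\<lambda>i. if i < Suc m then c i else 0) = (\<lambda>i. (if i < m then c i else 0) + c m * ?e i)"
      by (auto simp: less_Suc_eq)
    then have "T (\<lambda>i. if i < Suc m then c i else 0)
        = T (\<lambda>i. (if i < m then c i else 0) + c m * ?e i)"
      by simp
    also have "\<dots> = T (\<lambda>i. if i < m then c i else 0) + T (\<lambda>i. c m * ?e i)"
      using Suc.prems by (intro add) (auto simp: ell2_def)
    finally show ?case
      using Suc scale[OF e, of "c m"] by simp
  qed (simp add: zero)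
  then show ?thesis by simp
qed

text \<open>
  The value of \<open>opnorm_on\<close> bounds the map only if the supremum is taken over a bounded set. For \<open>T\<close> this follows
  from the expansion in unit vectors. For the inverse it follows from compactness of the unit sphere of
  \<open>\<ell>\<^sub>2\<^sup>n\<close>, in the product topology of \<open>nat \<Rightarrow> real\<close>: there \<open>\<parallel>T c\<parallel>\<close> attains a minimum, which is positive as \<open>T\<close> is
  injective.
\<close>

lemma ell2_iso_bounds:
  fixes T :: "(nat \<Rightarrow> real) \<Rightarrow> 'a::real_normed_vector"
  assumes T: "ell2_iso n T F" and c: "c \<in> ell2 n"
  defines "l \<equiv> \<lambda>c. L2_set c {..<n}"
  shows "norm (T c) \<le> opnorm_on (ell2 n) l norm T * l c"
    and "l c \<le> opnorm_on F norm l (inv_into (ell2 n) T) * norm (T c)"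
proof -
  let ?S = "inv_into (ell2 n) T"
  have scale: "T (\<lambda>i. r * c i) = r *\<^sub>R T c" if "c \<in> ell2 n" for r c
    using T that by (auto simp: ell2_iso_def)
  have inj: "inj_on T (ell2 n)" and F: "T ` ell2 n = F"
    using T by (auto simp: ell2_iso_def bij_betw_def)
  have ST: "?S (T c) = c" if "c \<in> ell2 n" for c
    using inj that by simp
  have zero: "(\<lambda>_. 0) \<in> ell2 n" "T (\<lambda>_. 0) = 0"
    using scale[of "\<lambda>_. 0" 0] by (simp_all add: ell2_def)
  have sc_ell2: "(\<lambda>i. r * c i) \<in> ell2 n" if "c \<in> ell2 n" for r c
    using that by (simp add: ell2_def)
  have l_scale: "l (\<lambda>i. r * c i) = \<bar>r\<bar> * l c" for r c
    using L2_set_right_distrib[of "\<bar>r\<bar>" c "{..<n}"]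
    by (simp add: l_def L2_set_def power_mult_distrib)
  have l0: "c = (\<lambda>_. 0)" if "c \<in> ell2 n" "l c = 0" for c
  proof
    fix i
    show "c i = 0"
      using that by (cases "i < n") (auto simp: l_def ell2_def L2_set_eq_0_iff)
  qed
  have l_nonneg: "0 \<le> l c" for c
    by (simp add: l_def)
  define e where "e i = (\<lambda>j. if j = i then 1 else 0 :: real)" for i :: nat
  have T_sum: "T c = (\<Sum>i<n. c i *\<^sub>R T (e i))" if "c \<in> ell2 n" for c
  proof -
    have "(\<lambda>i. if i < n then c i else 0) = c"
      using that by (auto simp: ell2_def)
    then show ?thesis
      using ell2_iso_sum[OF T, of c] by (simp add: e_def)
  qed

  have "bdd_above ((\<lambda>c. norm (T c)) ` {c \<in> ell2 n. l c \<le> 1})"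
  proof (rule bdd_aboveI2)
    fix c assume "c \<in> {c \<in> ell2 n. l c \<le> 1}"
    then have c: "c \<in> ell2 n" "l c \<le> 1" by auto
    have "norm (T c) \<le> (\<Sum>i<n. norm (c i *\<^sub>R T (e i)))"
      unfolding T_sum[OF c(1)] by (rule norm_sum)
    also have "\<dots> \<le> (\<Sum>i<n. norm (T (e i)))"
    proof (rule sum_mono)
      fix i assume "i \<in> {..<n}"
      then have "\<bar>c i\<bar> \<le> L2_set (\<lambda>i. \<bar>c i\<bar>) {..<n}"
        by (intro member_le_L2_set) auto
      then have "\<bar>c i\<bar> \<le> l c"
        by (simp add: l_def L2_set_def)
      then have "\<bar>c i\<bar> \<le> 1"
        using c(2) by linarith
      then show "norm (c i *\<^sub>R T (e i)) \<le> norm (T (e i))"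
        by (simp add: mult_left_le_one_le)
    qed
    finally show "norm (T c) \<le> (\<Sum>i<n. norm (T (e i)))" .
  qed
  then have up: "norm (T d) \<le> opnorm_on (ell2 n) l norm T" if "d \<in> ell2 n" "l d \<le> 1" for d
    unfolding opnorm_on_def using that by (intro cSUP_upper) auto
  show "norm (T c) \<le> opnorm_on (ell2 n) l norm T * l c"
  proof (cases "l c = 0")
    case True
    then show ?thesis using l0[OF c] zero by simp
  next
    case False
    then have pos: "0 < l c"
      using l_nonneg[of c] by simp
    then show ?thesis
      using up[OF sc_ell2[OF c, of "1 / l c"]] l_scale[of "1 / l c" c] scale[OF c, of "1 / l c"]
      by (simp add: divide_le_eq)
  qed

  obtain m where m: "0 < m" "\<And>c. c \<in> ell2 n \<Longrightarrow> l c = 1 \<Longrightarrow> m \<le> norm (T c)"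
  proof (cases "\<exists>c\<in>ell2 n. l c = 1")
    case False
    then show ?thesis using that[of 1] by auto
  next
    case True
    let ?box = "PiE UNIV (\<lambda>i. if i < n then {-1..1} else {0 :: real})"
    let ?s = "?box \<inter> {c. l c = 1}"
    have s: "c \<in> ?s \<longleftrightarrow> c \<in> ell2 n \<and> l c = 1" for c
    proof -
      have "c i \<in> {-1..1}" if "l c = 1" "i < n" for i
      proof -
        have "\<bar>c i\<bar> \<le> L2_set (\<lambda>i. \<bar>c i\<bar>) {..<n}"
          using that by (intro member_le_L2_set) auto
        then show ?thesis
          using that by (simp add: l_def L2_set_def abs_le_iff)
      qed
      then show ?thesis
        by (auto simp: ell2_def PiE_iff split: if_splits)
    qed
    have "compactin (product_topology (\<lambda>_. euclidean) UNIV) ?box"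
      unfolding compactin_PiE by simp
    then have "compact ?box"
      by (simp only: euclidean_product_topology compactin_euclidean_iff)
    moreover have "closed {c. l c = 1}"
      unfolding l_def L2_set_def
      by (intro closed_Collect_eq continuous_intros continuous_on_product_coordinates)
    ultimately have "compact ?s"
      by (rule compact_Int_closed)
    moreover have "?s \<noteq> {}"
      using True s by blast
    moreover have "continuous_on ?s (\<lambda>c. norm (\<Sum>i<n. c i *\<^sub>R T (e i)))"
      by (rule continuous_on_subset[of UNIV])
        (intro continuous_intros continuous_on_product_coordinates subset_UNIV)+
    ultimately have "\<exists>d\<in>?s. \<forall>c\<in>?s.
        norm (\<Sum>i<n. d i *\<^sub>R T (e i)) \<le> norm (\<Sum>i<n. c i *\<^sub>R T (e i))"
      by (rule continuous_attains_inf)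
    then obtain d where d: "d \<in> ?s"
      "\<And>c. c \<in> ?s \<Longrightarrow> norm (\<Sum>i<n. d i *\<^sub>R T (e i)) \<le> norm (\<Sum>i<n. c i *\<^sub>R T (e i))"
      by (elim bexE) (rule that, assumption, drule bspec)
    have dl: "d \<in> ell2 n" "l d = 1"
      using d(1) s by auto
    have "T d \<noteq> 0"
    proof
      assume "T d = 0"
      then have "d = (\<lambda>_. 0)"
        using inj_onD[OF inj, of d "\<lambda>_. 0"] dl zero by simp
      then show False
        using dl(2) by (simp add: l_def L2_set_def)
    qed
    then show ?thesis
    proof (intro that[of "norm (T d)"])
      fix c assume c: "c \<in> ell2 n" "l c = 1"
      show "norm (T d) \<le> norm (T c)"
        using d(2)[of c] s[of c] c by (simp only: T_sum dl(1) c(1) simp_thms)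
    qed simp
  qed
  have low: "m * l c \<le> norm (T c)" if c: "c \<in> ell2 n" for c
  proof (cases "l c = 0")
    case False
    then have pos: "0 < l c"
      using l_nonneg[of c] by simp
    then show ?thesis
      using m(2)[OF sc_ell2[OF c, of "1 / l c"]] l_scale[of "1 / l c" c] scale[OF c, of "1 / l c"]
      by (simp add: le_divide_eq)
  qed simp
  have "bdd_above ((\<lambda>y. l (?S y)) ` {y \<in> F. norm y \<le> 1})"
  proof (rule bdd_aboveI2)
    fix y assume "y \<in> {y \<in> F. norm y \<le> 1}"
    then obtain c where c: "c \<in> ell2 n" "y = T c" "norm (T c) \<le> 1"
      using F by auto
    have "m * l c \<le> 1"
      using low[OF c(1)] c(3) by simp
    then show "l (?S y) \<le> 1 / m"
      using m(1) by (simp add: c(2) ST[OF c(1)] le_divide_eq mult.commute)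
  qed
  then have up': "l (?S y) \<le> opnorm_on F norm l ?S" if "y \<in> F" "norm y \<le> 1" for y
    unfolding opnorm_on_def using that by (intro cSUP_upper) auto
  show "l c \<le> opnorm_on F norm l ?S * norm (T c)"
  proof (cases "T c = 0")
    case True
    then show ?thesis
      using low[OF c] m(1) by (simp add: mult_le_0_iff)
  next
    case False
    let ?r = "1 / norm (T c)"
    have "l (?S (T (\<lambda>i. ?r * c i))) \<le> opnorm_on F norm l ?S"
    proof (rule up')
      show "T (\<lambda>i. ?r * c i) \<in> F"
        using sc_ell2[OF c] F by blast
      show "norm (T (\<lambda>i. ?r * c i)) \<le> 1"
        unfolding scale[OF c] using False by simp
    qed
    then have "l (\<lambda>i. ?r * c i) \<le> opnorm_on F norm l ?S"
      by (simp only: ST[OF sc_ell2[OF c]])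
    then show ?thesis
      using False l_scale[of ?r c] by (simp add: divide_le_eq)
  qed
qed

text \<open>
  The coordinates are those of \<open>T\<^sup>-\<^sup>1 R x\<close>, where \<open>R\<close> is the projection, divided by the bound
  \<open>D = \<parallel>T\<^sup>-\<^sup>1\<parallel> C\<close> of \<open>T\<^sup>-\<^sup>1 R\<close>; the basis vectors \<open>T e\<^sub>i\<close> are multiplied by \<open>D\<close> in return. As \<open>C\<close> bounds only the
  product \<open>\<parallel>T\<parallel> \<parallel>T\<^sup>-\<^sup>1\<parallel>\<close>, this scaling is what makes \<open>K = C\<^sup>2\<close> independent of \<open>n\<close>.
\<close>

lemma exists_l2_system:
  assumes "contains_uniformly_complemented_ell2 TYPE('a::real_normed_vector)"
  obtains K where "0 \<le> K"
    "\<And>n. n \<ge> 1 \<Longrightarrow> \<exists>(w :: nat \<Rightarrow> 'a) \<psi>. l2_system n K w \<psi>"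
proof -
  obtain C and F :: "nat \<Rightarrow> 'a set" where CF: "\<And>n. n \<ge> 1 \<Longrightarrow> subspace (F n) \<and>
      isomorphic_ell2 C n (F n) \<and> (\<exists>Q. projection_onto Q (F n) \<and> onorm Q \<le> C)"
    using assms unfolding contains_uniformly_complemented_ell2_def by blast
  have "\<exists>(w :: nat \<Rightarrow> 'a) \<psi>. l2_system n (C * C) w \<psi>" if n: "n \<ge> 1" for n
  proof -
    define l where "l = (\<lambda>c. L2_set c {..<n})"
    obtain T where T: "ell2_iso n T (F n)"
      and TC: "opnorm_on (ell2 n) l norm T * opnorm_on (F n) norm l (inv_into (ell2 n) T) \<le> C"
      using CF[OF n] by (auto simp: isomorphic_ell2_def l_def)
    obtain R where R: "bounded_linear R" "\<And>x. R (R x) = R x" "range R = F n" "onorm R \<le> C"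
      using CF[OF n] by (auto simp: projection_onto_def)
    define S where "S = inv_into (ell2 n) T"
    define \<alpha> where "\<alpha> = opnorm_on (ell2 n) l norm T"
    define \<beta> where "\<beta> = opnorm_on (F n) norm l S"
    have \<alpha>: "norm (T c) \<le> \<alpha> * l c" and \<beta>: "l c \<le> \<beta> * norm (T c)" if "c \<in> ell2 n" for c
      using ell2_iso_bounds[OF T that] by (simp_all add: \<alpha>_def \<beta>_def l_def S_def)
    have C0: "0 \<le> C"
      using onorm_pos_le[OF R(1)] R(4) by linarith
    have bij: "bij_betw T (ell2 n) (F n)"
      using T by (simp add: ell2_iso_def)
    have ST: "S (T c) = c" if "c \<in> ell2 n" for c
      using bij that by (simp add: S_def bij_betw_def)
    have S_ell2: "S y \<in> ell2 n" and TS: "T (S y) = y" if "y \<in> F n" for y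
      using bij that bij_betw_inv_into_right[OF bij] inv_into_into[of y T "ell2 n"]
      by (auto simp: S_def bij_betw_def)
    have RF: "R x \<in> F n" for x
      using R(3) by blast
    have RT: "R (T c) = T c" if "c \<in> ell2 n" for c
    proof -
      have "T c \<in> range R"
        using bij that R(3) by (auto simp: bij_betw_def)
      then show ?thesis using R(2) by auto
    qed
    define e where "e i = (\<lambda>j. if j = i then 1 else 0 :: real)" for i :: nat
    have e: "e i \<in> ell2 n" if "i < n" for i
      using that by (auto simp: e_def ell2_def)
    have l_e: "l (e 0) = 1"
      using n by (simp add: l_def L2_set_def e_def if_distrib[where f = "\<lambda>x. x\<^sup>2"] cong: if_cong)
    define D where "D = \<beta> * C"
    have est: "l (S (R x)) \<le> D * norm x" for x
    proof -
      have b0: "0 \<le> \<beta>"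
      proof (rule ccontr)
        assume "\<not> 0 \<le> \<beta>"
        then have "\<beta> * norm (T (e 0)) \<le> 0"
          by (simp add: mult_le_0_iff)
        then have "l (e 0) \<le> 0"
          using \<beta>[OF e[of 0]] n by linarith
        then show False
          using l_e by simp
      qed
      have "l (S (R x)) \<le> \<beta> * norm (R x)"
        using \<beta>[OF S_ell2[OF RF[of x]]] TS[OF RF[of x]] by simp
      also have "\<dots> \<le> \<beta> * (C * norm x)"
        by (intro mult_left_mono b0 order_trans[OF onorm[OF R(1)]] mult_right_mono R(4) norm_ge_zero)
      finally show ?thesis
        by (simp add: D_def)
    qed
    have "D > 0"
    proof -
      have "l (S (R (T (e 0)))) = 1"
        using n e[of 0] l_e by (simp add: RT ST)
      then have "0 < D * norm (T (e 0))"
        using est[of "T (e 0)"] by simp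
      then show ?thesis
        using norm_ge_zero[of "T (e 0)"] by (auto simp: zero_less_mult_iff)
    qed
    define w where "w i = D *\<^sub>R T (e i)" for i
    define \<psi> where "\<psi> i x = S (R x) i / D" for i x
    have "l2_system n (C * C) w \<psi>"
    proof (rule l2_system.intro)
      have Radd: "R (x + y) = R x + R y" and Rscale: "R (r *\<^sub>R x) = r *\<^sub>R R x" for x y r
        using bounded_linear.linear[OF R(1)] by (simp_all add: linear_add linear_scale)
      have Sadd: "S (R (x + y)) = (\<lambda>i. S (R x) i + S (R y) i)" for x y
      proof -
        have mem: "(\<lambda>i. S (R x) i + S (R y) i) \<in> ell2 n"
          using S_ell2[OF RF[of x]] S_ell2[OF RF[of y]] by (simp add: ell2_def)
        have "T (\<lambda>i. S (R x) i + S (R y) i) = R (x + y)"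
          using T S_ell2[OF RF[of x]] S_ell2[OF RF[of y]] TS[OF RF[of x]] TS[OF RF[of y]]
          by (simp add: ell2_iso_def Radd)
        then show ?thesis
          using ST[OF mem] by simp
      qed
      have Sscale: "S (R (r *\<^sub>R x)) = (\<lambda>i. r * S (R x) i)" for x r
      proof -
        have mem: "(\<lambda>i. r * S (R x) i) \<in> ell2 n"
          using S_ell2[OF RF[of x]] by (simp add: ell2_def)
        have "T (\<lambda>i. r * S (R x) i) = R (r *\<^sub>R x)"
          using T S_ell2[OF RF[of x]] TS[OF RF[of x]]
          by (simp add: ell2_iso_def Rscale)
        then show ?thesis
          using ST[OF mem] by simp
      qed
      show "linear (\<psi> i)" for i
        by (rule linearI) (simp_all add: \<psi>_def Sadd Sscale add_divide_distrib)
      show "(\<Sum>i<n. (\<psi> i x)\<^sup>2) \<le> (norm x)\<^sup>2" for x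
      proof -
        have "(\<Sum>i<n. (\<psi> i x)\<^sup>2) = (l (S (R x)) / D)\<^sup>2"
          by (simp add: \<psi>_def power_divide l_def L2_set_def sum_divide_distrib sum_nonneg)
        also have "\<dots> \<le> (norm x)\<^sup>2"
          using est[of x] \<open>D > 0\<close>
          by (intro power_mono) (auto simp: divide_le_eq mult.commute l_def)
        finally show ?thesis .
      qed
      show "\<psi> i (w j) = (if i = j then 1 else 0)" if "i < n" "j < n" for i j
        using that \<open>D > 0\<close> by (simp add: \<psi>_def w_def Sscale RT e ST) (simp add: e_def)
      show "norm (\<Sum>i<n. c i *\<^sub>R w i) \<le> C * C * L2_set c {..<n}" for c
      proof -
        let ?c = "\<lambda>i. if i < n then c i else 0"
        have lc: "l ?c = L2_set c {..<n}"
          unfolding l_def by (rule L2_set_cong) auto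
        have "(\<Sum>i<n. c i *\<^sub>R w i) = D *\<^sub>R T ?c"
          unfolding ell2_iso_sum[OF T] by (simp add: w_def e_def scaleR_sum_right mult.commute)
        then have "norm (\<Sum>i<n. c i *\<^sub>R w i) = D * norm (T ?c)"
          using \<open>D > 0\<close> by simp
        also have "\<dots> \<le> D * (\<alpha> * l ?c)"
          using \<open>D > 0\<close> by (intro mult_left_mono \<alpha>) (auto simp: ell2_def)
        also have "\<dots> = (C * l ?c) * (\<alpha> * \<beta>)"
          by (simp add: D_def)
        also have "\<dots> \<le> (C * l ?c) * C"
          using TC C0 by (intro mult_left_mono) (auto simp: \<alpha>_def \<beta>_def S_def l_def)
        finally show ?thesis
          by (simp add: lc mult_ac)
      qed
    qed
    then show ?thesis by blast
  qed
  then show ?thesis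
    using that[of "C * C"] by simp
qed

section \<open>Nonexistence of projections\<close>

lemma hom_polys_subset_polys0:
  assumes "k \<ge> 1"
  shows "hom_polys k \<subseteq> polys0 k"
proof
  fix P :: "'a \<Rightarrow> real" assume P: "P \<in> hom_polys k"
  then obtain M where M: "bounded_multilinear k M" "\<And>x. P x = M (replicate k x)"
    by (auto simp: hom_polys_def)
  have "(\<lambda>x. 0) \<in> hom_polys j" for j
    unfolding hom_polys_def bounded_multilinear_def
    by (rule CollectI, rule exI[of _ "\<lambda>_. 0"]) (auto intro!: exI[of _ 0] simp: linear_iff)
  then have "P \<in> polys k"
    unfolding polys_def using P
    by (intro CollectI exI[of _ "\<lambda>j. if j = k then P else (\<lambda>x. 0)"])
       (auto simp: if_distrib[where f = "\<lambda>f. f _"] cong: if_cong)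
  moreover have "P 0 = 0"
  proof -
    obtain B where "\<And>xs. length xs = k \<Longrightarrow> \<bar>M xs\<bar> \<le> B * prod_list (map norm xs)"
      using M(1) by (auto simp: bounded_multilinear_def)
    from this[of "replicate k 0"] show ?thesis
      using assms by (simp add: M(2) power_0_left)
  qed
  ultimately show "P \<in> polys0 k"
    by (simp add: polys0_def)
qed

text \<open>
  With \<open>t\<close> fixed, the estimate reads \<open>t\<^sup>k N \<le> c (2N + k - 2)\<^sup>1\<^sup>/\<^sup>2\<close> for all \<open>N\<close>, which fails for large \<open>N\<close>.
\<close>

lemma no_bounded_retraction_onto_hom_polys:
  fixes Q :: "'a::real_normed_vector lip0 \<Rightarrow> 'a lip0"
  assumes X: "contains_uniformly_complemented_ell2 TYPE('a)" and k: "k \<ge> 2"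
    and Q: "bounded_linear Q" "\<And>f. Q f \<in> restrictions (polys k)"
      "\<And>f. f \<in> restrictions (hom_polys k) \<Longrightarrow> Q f = f"
  shows False
proof -
  obtain K where K: "0 \<le> K"
    "\<And>n. n \<ge> 1 \<Longrightarrow> \<exists>(w :: nat \<Rightarrow> 'a) \<psi>. l2_system n K w \<psi>"
    using exists_l2_system[OF X] by blast
  \<comment> \<open>\<open>K + 1\<close> in place of \<open>K\<close> only avoids a division by \<open>0\<close>.\<close>
  define t where "t = 1 / (k * (K + 1))"
  have t: "0 < t" "k * (t * K) \<le> 1"
    using K(1) k by (auto simp: t_def divide_le_eq)
  define c where "c = 2 ^ k * (onorm Q * exp 1)"
  have c0: "0 \<le> c"
    using onorm_pos_le[OF Q(1)] by (simp add: c_def)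
  have le: "(t ^ k)\<^sup>2 * N \<le> c\<^sup>2 * k" if N: "N \<ge> 1" for N :: nat
  proof -
    define n where "n = 2 * N + (k - 2)"
    obtain w :: "nat \<Rightarrow> 'a" and \<psi> where "l2_system n K w \<psi>"
      using K(2)[of n] N by (auto simp: n_def)
    then have "t ^ k * N \<le> 2 ^ k * (onorm Q * (exp 1 * sqrt n))"
      using k N Q t by (intro l2_system.projection_estimate) (auto simp: n_def)
    then have "t ^ k * N \<le> c * sqrt n"
      by (simp add: c_def mult_ac)
    then have "(t ^ k * N)\<^sup>2 \<le> (c * sqrt n)\<^sup>2"
      using t by (intro power_mono) auto
    also have "\<dots> = c\<^sup>2 * n"
      by (simp add: power_mult_distrib)
    also have "\<dots> \<le> c\<^sup>2 * (k * N)"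
    proof -
      obtain j where "k = j + 2"
        using k by (metis add.commute le_Suc_ex)
      then have "n \<le> k * N"
        using N by (simp add: n_def algebra_simps)
      then have "real n \<le> k * N"
        by (metis of_nat_le_iff of_nat_mult)
      then show ?thesis
        by (intro mult_left_mono) auto
    qed
    finally have "((t ^ k)\<^sup>2 * N) * N \<le> (c\<^sup>2 * k) * N"
      by (simp add: power_mult_distrib power2_eq_square mult_ac)
    then show ?thesis
      using N by simp
  qed
  obtain N :: nat where "c\<^sup>2 * k / (t ^ k)\<^sup>2 < N"
    using reals_Archimedean2 by blast
  then have N: "c\<^sup>2 * k < (t ^ k)\<^sup>2 * N"
    using t by (simp add: divide_less_eq mult.commute)
  then have "N \<ge> 1"
    using c0 by (cases N) (auto simp: mult_less_0_iff)
  with le[of N] N show False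
    by simp
qed

theorem theorem4p3:
  fixes k :: nat
  assumes "contains_uniformly_complemented_ell2 TYPE('a::banach)"
    and "k \<ge> 2"
  shows "\<not> complemented (restrictions (hom_polys k :: ('a \<Rightarrow> real) set)) \<and>
         \<not> complemented (restrictions (polys0 k :: ('a \<Rightarrow> real) set))"
proof -
  have no: "\<not> complemented (restrictions V)"
    if V: "hom_polys k \<subseteq> V" "V \<subseteq> polys k" for V :: "('a \<Rightarrow> real) set"
  proof
    assume "complemented (restrictions V)"
    then obtain Q where Q: "bounded_linear Q" "\<And>f. Q (Q f) = Q f" "range Q = restrictions V"
      by (auto simp: complemented_def projection_onto_def)
    have mono: "restrictions U \<subseteq> restrictions W" if "U \<subseteq> W" for U W :: "('a \<Rightarrow> real) set"
      using that by (auto simp: restrictions_def)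
    have "Q f \<in> restrictions (polys k)" for f
      using Q(3) mono[OF V(2)] by blast
    moreover have "Q f = f" if "f \<in> restrictions (hom_polys k)" for f
    proof -
      have "f \<in> range Q"
        using that mono[OF V(1)] Q(3) by blast
      then show ?thesis using Q(2) by auto
    qed
    ultimately show False
      using no_bounded_retraction_onto_hom_polys[OF assms Q(1)] by blast
  qed
  have "hom_polys k \<subseteq> (polys0 k :: ('a \<Rightarrow> real) set)" "(polys0 k :: ('a \<Rightarrow> real) set) \<subseteq> polys k"
    using hom_polys_subset_polys0[of k] assms(2) by (auto simp: polys0_def)
  then show ?thesis
    using no by blast
qed

end
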